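(* As $k\to\infty$ (over positive integers $k$), $HJ(k,2)=k(1-o(1))$.
   Context: Here $o(1)$ denotes a function of $k$ tending to $0$ as $k\to\infty$. For $k\in\mathbb{Z}^+$ let $[k]=\{1,2,\dots,k\}$. A variable word over $[k]$ of length $n$ is a vector $w(x)\in([k]\cup\{x\})^n$ containing at least one occurrence of $x$; for $a\in[k]$, $w(a)\in[k]^n$ is obtained by replacing every occurrence of $x$ by $a$. The combinatorial line determined by $w(x)$ is $\{w(a):a\in[k]\}$. A (combinatorial) $m$-line (partial combinatorial line of length $m$) in $[k]^n$ is a set of the form $\{w(a):a\in\{i+1,\dots,i+m\}\}$ with $w(x)$ a variable word and $0\le i\le k-m$. For $k_1,k_2\in\mathbb{Z}^+$ and $K=\max(k_1,k_2)$, the off-diagonal Hales-Jewett number $HJ(k_1,k_2)=HJ(k_1,k_2;2)$ is the least positive integer $n$ such that every $2$-coloring of $[K]^n$ contains a monochromatic $k_1$-line of color $1$ or a monochromatic $k_2$-line of color $2$. *)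

theory Defs
  imports Complex_Main "HOL-Library.FuncSet"
begin

definition words :: "nat \<Rightarrow> nat \<Rightarrow> nat list set" where
  "words k n = {p. length p = n \<and> set p \<subseteq> {1..k}}"

text \<open>The symbol \<open>None\<close> plays the role of the variable \<open>x\<close>.\<close>

definition variable_words :: "nat \<Rightarrow> nat \<Rightarrow> nat option list set" where
  "variable_words k n =
     {w. length w = n \<and> set w \<subseteq> Some ` {1..k} \<union> {None} \<and> None \<in> set w}"

definition subst_var :: "nat option list \<Rightarrow> nat \<Rightarrow> nat list" where
  "subst_var w a = map (\<lambda>s. case s of None \<Rightarrow> a | Some b \<Rightarrow> b) w"

text \<open>The condition \<open>0 \<le> i \<le> k - m\<close> is written as \<open>i + m \<le> k\<close> because subtraction
  on natural numbers truncates.\<close>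

definition is_line :: "nat \<Rightarrow> nat \<Rightarrow> nat \<Rightarrow> nat list set \<Rightarrow> bool" where
  "is_line k n m L \<longleftrightarrow>
     (\<exists>w \<in> variable_words k n. \<exists>i. i + m \<le> k \<and> L = subst_var w ` {i + 1..i + m})"

definition monochromatic :: "(nat list \<Rightarrow> nat) \<Rightarrow> nat \<Rightarrow> nat list set \<Rightarrow> bool" where
  "monochromatic c j L \<longleftrightarrow> (\<forall>p \<in> L. c p = j)"

definition HJ_property :: "nat \<Rightarrow> nat \<Rightarrow> nat \<Rightarrow> bool" where
  "HJ_property k1 k2 n \<longleftrightarrow>
     (\<forall>c \<in> words (max k1 k2) n \<rightarrow> {1, 2}.
        (\<exists>L. is_line (max k1 k2) n k1 L \<and> monochromatic c 1 L) \<or>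
        (\<exists>L. is_line (max k1 k2) n k2 L \<and> monochromatic c 2 L))"

text \<open>Meaningful for positive \<open>k1\<close> and \<open>k2\<close>; a suitable \<open>n\<close> then exists by the
  Hales-Jewett theorem.\<close>

definition HJ :: "nat \<Rightarrow> nat \<Rightarrow> nat" where
  "HJ k1 k2 = (LEAST n. 0 < n \<and> HJ_property k1 k2 n)"

end

theory Submission
  imports Defs "HOL-Number_Theory.Number_Theory" "HOL-Complex_Analysis.Complex_Analysis"
    "HOL-Real_Asymp.Real_Asymp"
begin

text \<open>
  The value of \<open>HJ k 2\<close> lies between the largest prime up to \<open>k\<close> and \<open>k + 1\<close>, and by the prime
  number theorem the largest prime up to \<open>k\<close> is asymptotic to \<open>k\<close>.

  Upper bound. A line of length 2 consists of two points that differ by raising some entries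
  with a common value \<open>a\<close> to \<open>a + 1\<close>. For \<open>0 \<le> i \<le> k\<close> consider the word consisting of the
  variable, then \<open>i\<close> letters 1, then \<open>k - i\<close> letters 2. Substituting a fixed letter into two of
  these words gives a line of length 2, so if there is no such line of colour 2, each letter puts
  at most one of the \<open>k + 1\<close> words onto a point of colour 2. One word escapes all \<open>k\<close> letters,
  and its line has colour 1 throughout.

  Lower bound. For a prime \<open>q \<le> k\<close> and a dimension \<open>n < q\<close>, give colour 2 to the points with
  coordinate sum divisible by \<open>q\<close>. Along a line with \<open>s\<close> variable positions the sum moves
  in steps of \<open>s\<close>, and \<open>0 < s < q\<close>. So two neighbours never both have colour 2, whereas
  \<open>q\<close> consecutive points run through all residues and meet colour 2.

  It remains to find primes in \<open>[(1 - \<delta>) k, k]\<close> for large \<open>k\<close>. The proof follows Newman.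
  His Tauberian theorem (\<open>newman_tauberian\<close>) says that a Dirichlet series with bounded
  coefficients converges at 1 if its sum extends holomorphically across the line \<open>Re z = 1\<close>.
  It is applied to the coefficients \<open>\<psi>(n)/n - 1\<close>, where \<open>\<psi>\<close> is the Chebyshev function: these are
  bounded by Chebyshev's estimate (\<open>chebyshev_psi_le\<close>), and the series extends because \<open>\<zeta>\<close>
  extends and has no zero with \<open>Re z \<ge> 1\<close> (\<open>zeta_reg_nonzero\<close>). The convergence of
  \<open>\<Sum> (\<psi>(n) - n)/n\<^sup>2\<close> is already enough: if \<open>\<psi>\<close> were almost constant on \<open>[(1 - \<delta>) k, k]\<close>, then
  \<open>\<psi>(n) - n\<close> would have constant sign and size of order \<open>k\<close> on a fixed proportion of that
  interval, against the Cauchy criterion (\<open>prime_in_interval_of_psi_convergent\<close>).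
\<close>

section \<open>Comparison of power sums with integrals\<close>

lemma powr_step_mvt:
  fixes y :: real
  assumes "t > 0"
  obtains \<xi> where "t < \<xi>" "\<xi> < t + 1" "(t + 1) powr y - t powr y = y * \<xi> powr (y - 1)"
proof -
  have "\<exists>z. t < z \<and> z < t + 1 \<and> (t + 1) powr y - t powr y = (t + 1 - t) * (y * z powr (y - 1))"
  proof (rule MVT2)
    fix x assume "t \<le> x" "x \<le> t + 1"
    with assms show "((\<lambda>x. x powr y) has_real_derivative y * x powr (y - 1)) (at x)"
      by (intro has_real_derivative_powr) auto
  qed auto
  then show ?thesis using that by auto
qed

lemma powr_tail_step:
  fixes x :: real
  assumes "x > 0" "n > 0"
  shows "real (Suc n) powr (-1 - x) \<le> (real n powr (-x) - real (Suc n) powr (-x)) / x"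
proof -
  obtain \<xi> where \<xi>: "real n < \<xi>" "\<xi> < real n + 1"
    "(real n + 1) powr (-x) - real n powr (-x) = (-x) * \<xi> powr (-x - 1)"
    using powr_step_mvt[of "real n" "-x"] assms by auto
  have "real (Suc n) powr (-1 - x) \<le> \<xi> powr (-1 - x)"
    using \<xi> assms by (intro powr_mono2') auto
  also have "\<xi> powr (-1 - x) = \<xi> powr (-x - 1)"
    by (rule arg_cong2[of _ _ _ _ "(powr)"]) auto
  also have "\<dots> = (real n powr (-x) - real (Suc n) powr (-x)) / x"
    using \<xi>(3) assms by (simp add: field_simps)
  finally show ?thesis .
qed

text \<open>
  Comparison of the tail with \<open>\<integral> t powr (-1 - x)\<close>, done by telescoping the antiderivative.
\<close>

lemma powr_tail_bound:
  fixes x :: real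
  assumes "x > 0" "N > 0"
  shows "summable (\<lambda>n. real (n + Suc N) powr (-1 - x))"
    and "(\<Sum>n. real (n + Suc N) powr (-1 - x)) \<le> real N powr (-x) / x"
proof -
  define u where "u n = real (n + N) powr (-x) / x" for n
  have "(\<lambda>n. u n) \<longlonglongrightarrow> 0"
    using assms unfolding u_def by real_asymp
  then have tel: "(\<lambda>n. u n - u (Suc n)) sums (u 0 - 0)"
    by (rule telescope_sums')
  have le: "real (n + Suc N) powr (-1 - x) \<le> u n - u (Suc n)" for n
    using powr_tail_step[of x "n + N"] assms by (simp add: u_def diff_divide_distrib)
  show s: "summable (\<lambda>n. real (n + Suc N) powr (-1 - x))"
    by (rule summable_comparison_test'[OF sums_summable[OF tel], of 0]) (use le in auto)
  have "(\<Sum>n. real (n + Suc N) powr (-1 - x)) \<le> (\<Sum>n. u n - u (Suc n))"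
    by (intro suminf_le le s sums_summable[OF tel])
  also have "\<dots> = real N powr (-x) / x"
    using sums_unique[OF tel] by (simp add: u_def)
  finally show "(\<Sum>n. real (n + Suc N) powr (-1 - x)) \<le> real N powr (-x) / x" .
qed

text \<open>
  The last term is kept separately so that one bound serves both signs of \<open>x - 1\<close>: the
  summand decreases for \<open>x \<le> 1\<close>, where the integral alone suffices, and increases for \<open>x \<ge> 1\<close>,
  where the comparison is with the interval to the right and the last term is left over.
\<close>

lemma powr_head_bound:
  fixes x :: real
  assumes "x > 0" "N > 0"
  shows "(\<Sum>n=1..N. real n powr (x - 1)) \<le> real N powr x / x + real N powr (x - 1)"
  using \<open>N > 0\<close>
proof (induction N rule: nat_induct_non_zero)
  case 1
  then show ?case using assms by simp
next
  case (Suc N)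
  obtain \<xi> where \<xi>: "real N < \<xi>" "\<xi> < real N + 1"
    "(real N + 1) powr x - real N powr x = x * \<xi> powr (x - 1)"
    using powr_step_mvt[of "real N" x] Suc.hyps by auto
  have eq: "real (Suc N) powr x / x = real N powr x / x + \<xi> powr (x - 1)"
    using \<xi>(3) assms by (simp add: field_simps)
  show ?case
  proof (cases "x \<ge> 1")
    case True
    have "real N powr (x - 1) \<le> \<xi> powr (x - 1)"
      using True \<xi> by (intro powr_mono2) auto
    then show ?thesis using Suc.IH eq by (simp add: add.commute)
  next
    case False
    have "(\<Sum>n=1..M. real n powr (x - 1)) \<le> real M powr x / x" if "M > 0" for M
      using that
    proof (induction M rule: nat_induct_non_zero)
      case 1
      then show ?case using False assms by simp
    next
      case (Suc M)
      obtain \<xi> where \<xi>: "real M < \<xi>" "\<xi> < real M + 1"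
        "(real M + 1) powr x - real M powr x = x * \<xi> powr (x - 1)"
        using powr_step_mvt[of "real M" x] Suc.hyps by auto
      have eq: "real (Suc M) powr x / x = real M powr x / x + \<xi> powr (x - 1)"
        using \<xi>(3) assms by (simp add: field_simps)
      have "real (Suc M) powr (x - 1) \<le> \<xi> powr (x - 1)"
        using False \<xi> by (intro powr_mono2') auto
      then show ?case using Suc.IH eq by simp
    qed
    from this[of "Suc N"] show ?thesis
      by (smt (verit) powr_ge_zero zero_less_Suc)
  qed
qed


section \<open>Newman's contour and kernel\<close>

text \<open>
  The left part of the contour and the left half circle both avoid the nonnegative real axis,
  and have the same end points, so Cauchy's theorem in this domain interchanges them.
\<close>

lemma starlike_slit_plane: "starlike (- {z :: complex. Im z = 0 \<and> Re z \<ge> 0})"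
  unfolding starlike_def
proof (intro bexI[of _ "-1"] ballI subsetI)
  fix x z :: complex
  assume x: "x \<in> - {z. Im z = 0 \<and> Re z \<ge> 0}" and z: "z \<in> closed_segment (-1) x"
  then obtain u where u: "0 \<le> u" "u \<le> 1" "z = (1 - u) *\<^sub>R (-1) + u *\<^sub>R x"
    by (auto simp: closed_segment_def)
  show "z \<in> - {z. Im z = 0 \<and> Re z \<ge> 0}"
  proof (rule ComplI, clarify)
    assume "Im z = 0" "Re z \<ge> 0"
    then have *: "u * Im x = 0" "u * Re x \<ge> 1 - u" using u by auto
    then have "u \<noteq> 0" by auto
    with * x have "Re x < 0" by auto
    then have "u * Re x < 0" using \<open>u \<noteq> 0\<close> u by (simp add: mult_pos_neg)
    then show False using * u by linarith
  qed
qed auto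

lemma open_slit_plane: "open (- {z :: complex. Im z = 0 \<and> Re z \<ge> 0})"
  by (intro open_Compl closed_Collect_conj closed_Collect_eq closed_Collect_le continuous_intros)

text \<open>
  Newman's kernel \<open>1/z + z/R\<^sup>2\<close>. It has residue 1 at 0, and on the circle of radius \<open>R\<close> it is
  real and proportional to \<open>Re z\<close>, which cancels the factor \<open>1/Re z\<close> in the bounds for tails and
  partial sums.
\<close>

definition newman_kernel :: "real \<Rightarrow> complex \<Rightarrow> complex" where
  "newman_kernel R z = (1 + z\<^sup>2 / of_real R ^ 2) / z"

lemma norm_newman_kernel_circle:
  assumes "norm z = R" "R > 0"
  shows "norm (newman_kernel R z) = 2 * \<bar>Re z\<bar> / R\<^sup>2"
proof -
  have z: "z \<noteq> 0" using assms by auto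
  have "of_real R ^ 2 = z * cnj z"
    using complex_norm_square[of z] assms by (simp flip: of_real_power)
  then have "newman_kernel R z = (z + cnj z) / of_real R ^ 2"
    using z by (simp add: newman_kernel_def field_simps power2_eq_square)
  also have "z + cnj z = of_real (2 * Re z)" by (simp add: complex_add_cnj)
  finally show ?thesis
    by (simp add: norm_divide norm_power abs_mult)
qed

lemma norm_newman_kernel_le:
  assumes "norm z \<le> B" "r \<le> norm z" "r > 0" "R > 0"
  shows "norm (newman_kernel R z) \<le> 1 / r + B / R\<^sup>2"
proof -
  have z: "z \<noteq> 0" using assms by auto
  then have "newman_kernel R z = 1 / z + z / of_real R ^ 2"
    by (simp add: newman_kernel_def field_simps power2_eq_square)
  also have "norm \<dots> \<le> norm (1 / z) + norm (z / of_real R ^ 2)" by (rule norm_triangle_ineq)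
  also have "\<dots> \<le> 1 / r + B / R\<^sup>2"
    using assms by (intro add_mono) (auto simp: norm_divide norm_power intro!: divide_left_mono divide_right_mono mult_pos_pos)
  finally show ?thesis .
qed

text \<open>
  The left part of Newman's contour, from \<open>\<i>R\<close> to \<open>-\<i>R\<close> along three sides of a rectangle of
  width \<open>d\<close>. The width is free, because the continued function is controlled only close to the
  imaginary axis.
\<close>

definition box_path :: "real \<Rightarrow> real \<Rightarrow> real \<Rightarrow> complex" where
  "box_path d R = linepath (Complex 0 R) (Complex (-d) R) +++
     (linepath (Complex (-d) R) (Complex (-d) (-R)) +++ linepath (Complex (-d) (-R)) (Complex 0 (-R)))"

lemma box_path_simps [simp]:
  "pathstart (box_path d R) = Complex 0 R" "pathfinish (box_path d R) = Complex 0 (-R)"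
  "valid_path (box_path d R)"
  by (auto simp: box_path_def)

lemma mem_closed_segment_complex_iff:
  "z \<in> closed_segment (Complex a b) (Complex c b) \<longleftrightarrow> Im z = b \<and> Re z \<in> closed_segment a c"
  "z \<in> closed_segment (Complex a b) (Complex a e) \<longleftrightarrow> Re z = a \<and> Im z \<in> closed_segment b e"
  by (auto simp: closed_segment_same_Im closed_segment_same_Re)

lemma path_image_box_path:
  assumes "d > 0" "R > 0"
  shows "path_image (box_path d R) =
    {z. Im z = R \<and> -d \<le> Re z \<and> Re z \<le> 0} \<union> {z. Re z = -d \<and> \<bar>Im z\<bar> \<le> R} \<union>
    {z. Im z = -R \<and> -d \<le> Re z \<and> Re z \<le> 0}"
  using assms unfolding box_path_def
  by (auto simp: path_image_join mem_closed_segment_complex_iff closed_segment_eq_real_ivl)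

lemma half_circle_ends:
  "pathstart (part_circlepath 0 R (-(pi/2)) (pi/2)) = Complex 0 (-R)"
  "pathfinish (part_circlepath 0 R (-(pi/2)) (pi/2)) = Complex 0 R"
  "pathstart (part_circlepath 0 R (pi/2) (3*pi/2)) = Complex 0 R"
  "pathfinish (part_circlepath 0 R (pi/2) (3*pi/2)) = Complex 0 (-R)"
proof -
  have "cis (3 * pi / 2) = cis pi * cis (pi / 2)"
    unfolding cis_mult by (rule arg_cong[of _ _ cis]) (simp add: field_simps)
  also have "\<dots> = -\<i>" by simp
  finally have "exp (\<i> * of_real (3 * pi / 2)) = -\<i>" by (simp add: cis_conv_exp)
  moreover have "exp (\<i> * of_real (pi / 2)) = \<i>" "exp (\<i> * of_real (-(pi / 2))) = -\<i>"
    by (metis cis_conv_exp cis_pi_half) (metis cis_conv_exp cis_minus_pi_half)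
  ultimately show
   "pathstart (part_circlepath 0 R (-(pi/2)) (pi/2)) = Complex 0 (-R)"
  "pathfinish (part_circlepath 0 R (-(pi/2)) (pi/2)) = Complex 0 R"
  "pathstart (part_circlepath 0 R (pi/2) (3*pi/2)) = Complex 0 R"
  "pathfinish (part_circlepath 0 R (pi/2) (3*pi/2)) = Complex 0 (-R)"
    by (simp_all add: complex_eq_iff)
qed

text \<open>
  At the two end points the bound \<open>1/Re z\<close> is meaningless; they are exceptional points in the
  estimates below.
\<close>

lemma right_half_circle:
  assumes "R > 0" "z \<in> path_image (part_circlepath 0 R (-(pi/2)) (pi/2))"
  shows "norm z = R" "Re z > 0 \<or> z \<in> {Complex 0 R, Complex 0 (-R)}"
proof -
  from assms obtain t where t: "-(pi/2) \<le> t" "t \<le> pi/2" "z = of_real R * cis t"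
    by (auto simp: path_image_part_circlepath' closed_segment_eq_real_ivl)
  show n: "norm z = R" using assms t by (simp add: norm_mult)
  have "Re z \<ge> 0" using t assms cos_ge_zero[of t] by simp
  moreover have "z \<in> {Complex 0 R, Complex 0 (-R)}" if "Re z = 0"
  proof -
    have "\<bar>Im z\<bar> = R" using n that by (simp add: cmod_def)
    then show ?thesis using that by (auto simp: complex_eq_iff abs_if split: if_splits)
  qed
  ultimately show "Re z > 0 \<or> z \<in> {Complex 0 R, Complex 0 (-R)}" by force
qed

lemma left_half_circle:
  assumes "R > 0" "z \<in> path_image (part_circlepath 0 R (pi/2) (3*pi/2))"
  shows "norm z = R" "Re z < 0 \<or> z \<in> {Complex 0 R, Complex 0 (-R)}"
proof -
  from assms obtain t where t: "pi/2 \<le> t" "t \<le> 3*pi/2" "z = of_real R * cis t"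
    by (auto simp: path_image_part_circlepath' closed_segment_eq_real_ivl)
  show n: "norm z = R" using assms t by (simp add: norm_mult)
  have "cos t = - cos (t - pi)" by (simp add: cos_diff)
  then have "Re z \<le> 0" using t assms cos_ge_zero[of "t - pi"]
    by (simp add: mult_le_0_iff)
  moreover have "z \<in> {Complex 0 R, Complex 0 (-R)}" if "Re z = 0"
  proof -
    have "\<bar>Im z\<bar> = R" using n that by (simp add: cmod_def)
    then show ?thesis using that by (auto simp: complex_eq_iff abs_if split: if_splits)
  qed
  ultimately show "Re z < 0 \<or> z \<in> {Complex 0 R, Complex 0 (-R)}" by force
qed

lemma box_path_eq_left_half_circle:
  assumes "d > 0" "R > 0" "h holomorphic_on (- {z. Im z = 0 \<and> Re z \<ge> 0})"
  shows "contour_integral (box_path d R) h = contour_integral (part_circlepath 0 R (pi/2) (3*pi/2)) h"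
    and "h contour_integrable_on box_path d R"
    and "h contour_integrable_on part_circlepath 0 R (pi/2) (3*pi/2)"
proof -
  let ?T = "- {z. Im z = 0 \<and> Re z \<ge> 0}"
  have im: "path_image (box_path d R) \<subseteq> ?T"
    using assms by (auto simp: path_image_box_path)
  have im2: "path_image (part_circlepath 0 R (pi/2) (3*pi/2)) \<subseteq> ?T"
    using left_half_circle[OF assms(2)] assms(2) by fastforce
  show 1: "h contour_integrable_on box_path d R"
    using contour_integrable_holomorphic_simple[OF assms(3) open_slit_plane _ im] by simp
  show 2: "h contour_integrable_on part_circlepath 0 R (pi/2) (3*pi/2)"
    using contour_integrable_holomorphic_simple[OF assms(3) open_slit_plane _ im2] by simp
  have "(h has_contour_integral 0) (box_path d R +++ reversepath (part_circlepath 0 R (pi/2) (3*pi/2)))"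
    using im im2 half_circle_ends
    by (intro Cauchy_theorem_starlike_simple[OF open_slit_plane starlike_slit_plane assms(3)])
      (auto simp: path_image_join valid_path_join simp del: reversepath_part_circlepath pathstart_part_circlepath pathfinish_part_circlepath)
  moreover have "contour_integral (box_path d R +++ reversepath (part_circlepath 0 R (pi/2) (3*pi/2))) h
     = contour_integral (box_path d R) h - contour_integral (part_circlepath 0 R (pi/2) (3*pi/2)) h"
    using 1 2 half_circle_ends
    by (subst contour_integral_join) (auto simp: contour_integral_reversepath contour_integrable_reversepath
        simp del: reversepath_part_circlepath pathstart_part_circlepath pathfinish_part_circlepath)
  ultimately show "contour_integral (box_path d R) h = contour_integral (part_circlepath 0 R (pi/2) (3*pi/2)) h"
    using contour_integral_unique by fastforce
qed

lemma half_circle_inverse: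
  assumes "R > 0"
  shows "((\<lambda>z. 1 / z) has_contour_integral (\<i> * pi)) (part_circlepath 0 R (-(pi/2)) (pi/2))"
    and "((\<lambda>z. 1 / z) has_contour_integral (\<i> * pi)) (part_circlepath 0 R (pi/2) (3*pi/2))"
proof -
  have e: "(\<lambda>t. 1 / (0 + of_real R * cis t) * of_real R * \<i> * cis t) = (\<lambda>t. \<i>)"
    using assms by (auto simp: field_simps)
  have "((\<lambda>t. \<i>) has_integral (measure lborel {-(pi/2)..pi/2} *\<^sub>R \<i>)) {-(pi/2)..pi/2}"
    by (rule has_integral_const_real)
  then show "((\<lambda>z. 1 / z) has_contour_integral (\<i> * pi)) (part_circlepath 0 R (-(pi/2)) (pi/2))"
    by (subst has_contour_integral_part_circlepath_iff) (simp_all only: e, auto simp: scaleR_conv_of_real mult.commute)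
  have "((\<lambda>t. \<i>) has_integral (measure lborel {pi/2..3*pi/2} *\<^sub>R \<i>)) {pi/2..3*pi/2}"
    by (rule has_integral_const_real)
  then show "((\<lambda>z. 1 / z) has_contour_integral (\<i> * pi)) (part_circlepath 0 R (pi/2) (3*pi/2))"
    by (subst has_contour_integral_part_circlepath_iff) (simp_all only: e, auto simp: scaleR_conv_of_real mult.commute)
qed

text \<open>
  Cauchy's integral formula on the closed contour made of the right half circle and the box.
  The winding number is 1: each of the two parts contributes a half turn, the box by
  deformation to the left half circle.
\<close>

lemma cauchy_half_circle_box:
  assumes "d > 0" "R > 0" and D: "convex D" "open D" "0 \<in> D" "f holomorphic_on D"
    and im: "path_image (part_circlepath 0 R (-(pi/2)) (pi/2)) \<subseteq> D" "path_image (box_path d R) \<subseteq> D"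
  shows "contour_integral (part_circlepath 0 R (-(pi/2)) (pi/2)) (\<lambda>z. f z / z)
       + contour_integral (box_path d R) (\<lambda>z. f z / z) = 2 * pi * \<i> * f 0"
    and "(\<lambda>z. f z / z) contour_integrable_on part_circlepath 0 R (-(pi/2)) (pi/2)"
    and "(\<lambda>z. f z / z) contour_integrable_on box_path d R"
proof -
  let ?A = "part_circlepath 0 R (-(pi/2)) (pi/2)" and ?B = "box_path d R"
  have nz: "0 \<notin> path_image ?A" "0 \<notin> path_image ?B"
    using right_half_circle(1)[OF assms(2), of 0] assms(1,2) by (auto simp: path_image_box_path)
  have hol: "(\<lambda>z. f z / z) holomorphic_on (D - {0})"
    using D by (intro holomorphic_intros) (auto intro: holomorphic_on_subset)
  have op: "open (D - {0})" using D by auto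
  show 1: "(\<lambda>z. f z / z) contour_integrable_on ?A"
    by (rule contour_integrable_holomorphic_simple[OF hol op]) (use im nz in auto)
  show 2: "(\<lambda>z. f z / z) contour_integrable_on ?B"
    by (rule contour_integrable_holomorphic_simple[OF hol op]) (use im nz in auto)
  have v: "valid_path (?A +++ ?B)" by (intro valid_path_join) (auto simp: half_circle_ends simp del: pathstart_part_circlepath pathfinish_part_circlepath)
  have pi: "path_image (?A +++ ?B) \<subseteq> D - {0}"
    using im nz by (subst path_image_join) (auto simp: half_circle_ends simp del: pathstart_part_circlepath pathfinish_part_circlepath)
  have inv: "(\<lambda>z. 1 / z) holomorphic_on (- {z :: complex. Im z = 0 \<and> Re z \<ge> 0})"
    by (intro holomorphic_intros) auto
  have "contour_integral (?A +++ ?B) (\<lambda>z. 1 / z) = contour_integral ?A (\<lambda>z. 1 / z) + contour_integral ?B (\<lambda>z. 1 / z)"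
    using half_circle_inverse(1)[OF assms(2)] box_path_eq_left_half_circle(2)[OF assms(1,2) inv]
    by (intro contour_integral_join) (auto simp: half_circle_ends contour_integrable_on_def simp del: pathstart_part_circlepath pathfinish_part_circlepath)
  also have "\<dots> = 2 * pi * \<i>"
    using box_path_eq_left_half_circle(1)[OF assms(1,2) inv] half_circle_inverse[OF assms(2)]
    by (simp add: contour_integral_unique)
  finally have wn: "winding_number (?A +++ ?B) 0 = 1"
    using v pi by (subst winding_number_valid_path) auto
  have "((\<lambda>w. f w / (w - 0)) has_contour_integral (2 * pi * \<i> * winding_number (?A +++ ?B) 0 * f 0)) (?A +++ ?B)"
    using D v pi by (intro Cauchy_integral_formula_convex_simple[where S = D]) (auto simp: interior_open half_circle_ends simp del: pathstart_part_circlepath pathfinish_part_circlepath)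
  then have "contour_integral (?A +++ ?B) (\<lambda>z. f z / z) = 2 * pi * \<i> * f 0"
    using wn by (simp add: contour_integral_unique)
  then show "contour_integral ?A (\<lambda>z. f z / z) + contour_integral ?B (\<lambda>z. f z / z) = 2 * pi * \<i> * f 0"
    using 1 2 by (subst (asm) contour_integral_join) (auto simp: half_circle_ends simp del: pathstart_part_circlepath pathfinish_part_circlepath)
qed


lemma contour_integral_box_path_bound:
  assumes "d > 0" "R > 0" and int: "g contour_integrable_on box_path d R" and "B1 \<ge> 0" "B2 \<ge> 0"
    and hor: "\<And>z. \<bar>Im z\<bar> = R \<Longrightarrow> -d \<le> Re z \<Longrightarrow> Re z \<le> 0 \<Longrightarrow> norm (g z) \<le> B1"
    and ver: "\<And>z. Re z = -d \<Longrightarrow> \<bar>Im z\<bar> \<le> R \<Longrightarrow> norm (g z) \<le> B2"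
  shows "norm (contour_integral (box_path d R) g) \<le> 2 * d * B1 + 2 * R * B2"
proof -
  let ?p1 = "linepath (Complex 0 R) (Complex (-d) R)"
  let ?p2 = "linepath (Complex (-d) R) (Complex (-d) (-R))"
  let ?p3 = "linepath (Complex (-d) (-R)) (Complex 0 (-R))"
  have i: "g contour_integrable_on ?p1" "g contour_integrable_on ?p2" "g contour_integrable_on ?p3"
    using int by (auto simp: box_path_def)
  have eq: "contour_integral (box_path d R) g =
      contour_integral ?p1 g + (contour_integral ?p2 g + contour_integral ?p3 g)"
    unfolding box_path_def using i by simp
  have l: "norm (Complex (-d) R - Complex 0 R) = d" "norm (Complex (-d) (-R) - Complex (-d) R) = 2 * R"
    "norm (Complex 0 (-R) - Complex (-d) (-R)) = d"
    using assms(1,2) by (simp_all add: cmod_def real_sqrt_mult)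
  have 1: "norm (contour_integral ?p1 g) \<le> B1 * norm (Complex (-d) R - Complex 0 R)"
    using assms by (intro contour_integral_bound_linepath i hor)
      (auto simp: mem_closed_segment_complex_iff closed_segment_eq_real_ivl)
  have 2: "norm (contour_integral ?p2 g) \<le> B2 * norm (Complex (-d) (-R) - Complex (-d) R)"
    using assms by (intro contour_integral_bound_linepath i ver)
      (auto simp: mem_closed_segment_complex_iff closed_segment_eq_real_ivl)
  have 3: "norm (contour_integral ?p3 g) \<le> B1 * norm (Complex 0 (-R) - Complex (-d) (-R))"
    using assms by (intro contour_integral_bound_linepath i hor)
      (auto simp: mem_closed_segment_complex_iff closed_segment_eq_real_ivl)
  have "norm (contour_integral (box_path d R) g) \<le>
      norm (contour_integral ?p1 g) + (norm (contour_integral ?p2 g) + norm (contour_integral ?p3 g))"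
    unfolding eq by (meson norm_triangle_ineq norm_triangle_le add_left_mono order.trans)
  with 1 2 3 show ?thesis unfolding l by (simp add: algebra_simps)
qed

section \<open>Newman's Tauberian theorem\<close>

lemma norm_of_nat_powr [simp]: "norm (of_nat n powr z :: complex) = real n powr Re z"
  using norm_powr_real_powr[of "of_nat n" z] by simp

text \<open>
  The argument is shifted by 1, so that the boundary point 1 of the theorem becomes 0.
\<close>

definition dirichlet_psum :: "(nat \<Rightarrow> complex) \<Rightarrow> nat \<Rightarrow> complex \<Rightarrow> complex" where
  "dirichlet_psum a N z = (\<Sum>n=1..N. a n * of_nat n powr (-1 - z))"

lemma holomorphic_dirichlet_psum: "dirichlet_psum a N holomorphic_on A"
  unfolding dirichlet_psum_def[abs_def] by (intro holomorphic_intros) auto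

lemma dirichlet_tail_bound:
  fixes a :: "nat \<Rightarrow> complex"
  assumes bd: "\<And>n. norm (a n) \<le> C" and s: "(\<lambda>n. a n * of_nat n powr (-1 - z)) sums G"
    and z: "Re z > 0" and N: "N > 0"
  shows "norm (G - dirichlet_psum a N z) \<le> C * (real N powr (- Re z) / Re z)"
proof -
  define f where "f n = a n * of_nat n powr (-1 - z)" for n
  have "(\<Sum>i<Suc N. f i) = (\<Sum>i=1..N. f i)"
    by (rule sum.mono_neutral_right) (auto simp: f_def not_le)
  then have "(\<lambda>i. f (i + Suc N)) sums (G - dirichlet_psum a N z)"
    using sums_split_initial_segment[OF s, of "Suc N"] by (simp add: f_def dirichlet_psum_def)
  then have "G - dirichlet_psum a N z = (\<Sum>i. f (i + Suc N))" by (rule sums_unique)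
  also have "norm \<dots> \<le> (\<Sum>i. C * real (i + Suc N) powr (-1 - Re z))"
  proof (rule norm_suminf_le)
    show "norm (f (i + Suc N)) \<le> C * real (i + Suc N) powr (-1 - Re z)" for i
      unfolding f_def norm_mult norm_of_nat_powr by (auto intro!: mult_right_mono bd)
    show "summable (\<lambda>i. C * real (i + Suc N) powr (-1 - Re z))"
      by (intro summable_mult powr_tail_bound z N)
  qed
  also have "\<dots> = C * (\<Sum>i. real (i + Suc N) powr (-1 - Re z))"
    by (intro suminf_mult powr_tail_bound z N)
  also have "\<dots> \<le> C * (real N powr (- Re z) / Re z)"
    using order.trans[OF norm_ge_zero bd[of 0]] by (intro mult_left_mono powr_tail_bound z N) auto
  finally show ?thesis .
qed

lemma dirichlet_head_bound:
  fixes a :: "nat \<Rightarrow> complex"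
  assumes bd: "\<And>n. norm (a n) \<le> C" and z: "Re z < 0" and N: "N > 0"
  shows "norm (dirichlet_psum a N z) \<le> C * (real N powr (- Re z) / (- Re z) + real N powr (- Re z - 1))"
proof -
  have C: "C \<ge> 0" using order.trans[OF norm_ge_zero bd[of 0]] .
  have "norm (dirichlet_psum a N z) \<le> (\<Sum>n=1..N. C * real n powr (- Re z - 1))"
    unfolding dirichlet_psum_def
  proof (rule sum_norm_le)
    fix n
    have "norm (a n * of_nat n powr (-1 - z)) = norm (a n) * real n powr (- Re z - 1)"
    proof -
      have "Re (-1 - z) = - Re z - 1" by simp
      then show ?thesis by (simp only: norm_mult norm_of_nat_powr)
    qed
    also have "\<dots> \<le> C * real n powr (- Re z - 1)"
      by (intro mult_right_mono bd) auto
    finally show "norm (a n * of_nat n powr (-1 - z)) \<le> C * real n powr (- Re z - 1)" .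
  qed
  also have "\<dots> = C * (\<Sum>n=1..N. real n powr (- Re z - 1))" by (simp add: sum_distrib_left)
  also have "\<dots> \<le> C * (real N powr (- Re z) / (- Re z) + real N powr (- Re z - 1))"
    using z N C by (intro mult_left_mono powr_head_bound) auto
  finally show ?thesis .
qed

text \<open>
  The tail is at most \<open>C N powr (-x) / x\<close> with \<open>x = Re z\<close>; the factor \<open>N powr z\<close> removes the
  power of \<open>N\<close> and the kernel removes \<open>1/x\<close>. What is left is \<open>2C/R\<^sup>2\<close> on an arc of length
  \<open>\<pi>R\<close>, uniformly in \<open>N\<close>.
\<close>

lemma newman_right_arc_bound:
  fixes a :: "nat \<Rightarrow> complex"
  assumes bd: "\<And>n. norm (a n) \<le> C" and N: "N > 0" and R: "R > 0"
    and s: "\<And>z. Re z > 0 \<Longrightarrow> (\<lambda>n. a n * of_nat n powr (-1 - z)) sums G z"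
    and int: "(\<lambda>z. (G z - dirichlet_psum a N z) * of_nat N powr z * newman_kernel R z)
       contour_integrable_on part_circlepath 0 R (-(pi/2)) (pi/2)"
  shows "norm (contour_integral (part_circlepath 0 R (-(pi/2)) (pi/2))
     (\<lambda>z. (G z - dirichlet_psum a N z) * of_nat N powr z * newman_kernel R z)) \<le> 2 * pi * (C / R)"
proof -
  have C: "C \<ge> 0" using order.trans[OF norm_ge_zero bd[of 0]] .
  have "norm (contour_integral (part_circlepath 0 R (-(pi/2)) (pi/2))
     (\<lambda>z. (G z - dirichlet_psum a N z) * of_nat N powr z * newman_kernel R z)) \<le> 2 * C / R\<^sup>2 * R * (pi/2 - -(pi/2))"
  proof (rule has_contour_integral_bound_part_circlepath_strong[OF has_contour_integral_integral[OF int],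
        where k = "{Complex 0 R, Complex 0 (-R)}"])
    fix z assume z: "z \<in> path_image (part_circlepath 0 R (-(pi/2)) (pi/2)) - {Complex 0 R, Complex 0 (-R)}"
    then have n: "norm z = R" and x: "Re z > 0" using right_half_circle[OF R] by auto
    have "norm ((G z - dirichlet_psum a N z) * of_nat N powr z * newman_kernel R z) \<le>
        C * (real N powr (- Re z) / Re z) * real N powr Re z * (2 * \<bar>Re z\<bar> / R\<^sup>2)"
      unfolding norm_mult norm_of_nat_powr norm_newman_kernel_circle[OF n R]
      using C x by (intro mult_right_mono dirichlet_tail_bound bd s x N) auto
    also have "\<dots> = 2 * C / R\<^sup>2"
      using N x by (simp add: powr_minus field_simps)
    finally show "norm ((G z - dirichlet_psum a N z) * of_nat N powr z * newman_kernel R z) \<le> 2 * C / R\<^sup>2" .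
  qed (use C R in auto)
  also have "\<dots> = 2 * pi * (C / R)" using R by (simp add: field_simps power2_eq_square)
  finally show ?thesis .
qed

text \<open>
  The mirror image of the bound on the right arc, now for the partial sum itself; the term
  \<open>C/N\<close> comes from the last summand in the bound for power sums.
\<close>

lemma newman_left_arc_bound:
  fixes a :: "nat \<Rightarrow> complex"
  assumes bd: "\<And>n. norm (a n) \<le> C" and N: "N > 0" and R: "R > 0"
    and int: "(\<lambda>z. dirichlet_psum a N z * of_nat N powr z * newman_kernel R z)
       contour_integrable_on part_circlepath 0 R (pi/2) (3*pi/2)"
  shows "norm (contour_integral (part_circlepath 0 R (pi/2) (3*pi/2))
     (\<lambda>z. dirichlet_psum a N z * of_nat N powr z * newman_kernel R z)) \<le> 2 * pi * (C / R + C / N)"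
proof -
  have C: "C \<ge> 0" using order.trans[OF norm_ge_zero bd[of 0]] .
  have "norm (contour_integral (part_circlepath 0 R (pi/2) (3*pi/2))
     (\<lambda>z. dirichlet_psum a N z * of_nat N powr z * newman_kernel R z)) \<le>
       (2 * C / R\<^sup>2 + 2 * C / (R * N)) * R * (3*pi/2 - pi/2)"
  proof (rule has_contour_integral_bound_part_circlepath_strong[OF has_contour_integral_integral[OF int],
        where k = "{Complex 0 R, Complex 0 (-R)}"])
    fix z assume z: "z \<in> path_image (part_circlepath 0 R (pi/2) (3*pi/2)) - {Complex 0 R, Complex 0 (-R)}"
    then have n: "norm z = R" and x: "Re z < 0" using left_half_circle[OF R] by auto
    have xR: "\<bar>Re z\<bar> \<le> R" using abs_Re_le_cmod[of z] n by simp
    have "norm (dirichlet_psum a N z * of_nat N powr z * newman_kernel R z) \<le>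
        C * (real N powr (- Re z) / (- Re z) + real N powr (- Re z - 1)) * real N powr Re z * (2 * \<bar>Re z\<bar> / R\<^sup>2)"
      unfolding norm_mult norm_of_nat_powr norm_newman_kernel_circle[OF n R]
      using C x by (intro mult_right_mono dirichlet_head_bound bd x N) (auto intro: divide_nonpos_nonneg)
    also have "\<dots> = C * (1 / \<bar>Re z\<bar> + 1 / N) * (2 * \<bar>Re z\<bar> / R\<^sup>2)"
    proof -
      have "(real N powr (- Re z) / (- Re z) + real N powr (- Re z - 1)) * real N powr Re z = 1 / \<bar>Re z\<bar> + 1 / N"
        using N x by (simp add: powr_minus powr_diff field_simps)
      then show ?thesis by (simp add: mult.assoc)
    qed
    also have "\<dots> = 2 * C / R\<^sup>2 + 2 * C / N * (\<bar>Re z\<bar> / R\<^sup>2)"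
      using x R N by (simp add: field_simps)
    also have "\<bar>Re z\<bar> / R\<^sup>2 \<le> R / R\<^sup>2" using xR by (intro divide_right_mono) auto
    then have "2 * C / R\<^sup>2 + 2 * C / N * (\<bar>Re z\<bar> / R\<^sup>2) \<le> 2 * C / R\<^sup>2 + 2 * C / N * (R / R\<^sup>2)"
      using C by (intro add_left_mono mult_left_mono) auto
    also have "\<dots> = 2 * C / R\<^sup>2 + 2 * C / (R * N)"
      using R by (simp add: power2_eq_square)
    finally show "norm (dirichlet_psum a N z * of_nat N powr z * newman_kernel R z) \<le> 2 * C / R\<^sup>2 + 2 * C / (R * N)" .
  qed (use C R in auto)
  also have "\<dots> = 2 * pi * (C / R + C / N)" using R N by (simp add: field_simps power2_eq_square)
  finally show ?thesis .
qed


text \<open>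
  Compactness of the closed half disc gives a uniform margin to the left of the imaginary axis.
\<close>

lemma open_nbhd_half_plane_contains_half_disc:
  assumes "open W" "{z. Re z \<ge> 0} \<subseteq> W"
  obtains e where "e > 0" "e \<le> 1" "{z. Re z > -e} \<inter> ball 0 (R + 1) \<subseteq> W"
proof -
  define K where "K = cball 0 (R + 1) \<inter> {z :: complex. Re z \<ge> 0}"
  have "compact K" unfolding K_def
    by (intro compact_Int_closed compact_cball closed_halfspace_Re_ge)
  moreover have "K \<subseteq> W" using assms by (auto simp: K_def)
  ultimately obtain e where e: "e > 0" "(\<Union>x\<in>K. cball x e) \<subseteq> W"
    using compact_subset_open_imp_cball_epsilon_subset[OF _ assms(1)] by blast
  have "z \<in> W" if "Re z > -min e 1" "norm z < R + 1" for z
  proof (cases "Re z \<ge> 0")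
    case True
    then show ?thesis using assms by auto
  next
    case False
    define x where "x = Complex 0 (Im z)"
    have "norm x \<le> norm z" using abs_Im_le_cmod[of z] by (simp add: x_def cmod_def)
    then have "x \<in> K" using that by (auto simp: K_def x_def)
    moreover have "z \<in> cball x e" using False that by (simp add: x_def dist_norm cmod_def)
    ultimately show ?thesis using e(2) by blast
  qed
  then have "{z. Re z > -min e 1} \<inter> ball 0 (R + 1) \<subseteq> W" by auto
  then show ?thesis using e(1) by (intro that[of "min e 1"]) auto
qed

text \<open>
  Cauchy's formula expresses \<open>G 0 - S\<^sub>N 0\<close> as the integral of \<open>(G - S\<^sub>N) N\<^sup>z K\<close> over the contour.
  The right arc contributes at most \<open>C/R\<close>. On the left the two functions are separated: \<open>S\<^sub>N\<close> is
  entire, so its integral may be moved to the left half circle and contributes at most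
  \<open>C/R + C/N\<close>, while \<open>G\<close> does not depend on \<open>N\<close> and is suppressed by \<open>N\<^sup>z\<close>.
\<close>

lemma newman_estimate:
  fixes a :: "nat \<Rightarrow> complex"
  assumes bd: "\<And>n. norm (a n) \<le> C"
    and W: "open W" "{z. Re z \<ge> 0} \<subseteq> W" and hol: "G holomorphic_on W"
    and s: "\<And>z. Re z > 0 \<Longrightarrow> (\<lambda>n. a n * of_nat n powr (-1 - z)) sums G z"
    and R: "R > 0" and \<eta>: "\<eta> > 0"
  shows "\<forall>\<^sub>F N in sequentially. norm (G 0 - dirichlet_psum a N 0) \<le> 2 * C / R + C / N + \<eta>"
proof -
  obtain e where e: "e > 0" "e \<le> 1" and eD: "{z. Re z > -e} \<inter> ball 0 (R + 1) \<subseteq> W"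
    using open_nbhd_half_plane_contains_half_disc[OF W] by blast
  define D where "D = {z. Re z > -e} \<inter> ball 0 (R + 1)"
  have D: "convex D" "open D" "0 \<in> D" "D \<subseteq> W"
    using eD e R by (auto simp: D_def intro!: convex_Int open_Int convex_halfspace_Re_gt open_halfspace_Re_gt)
  define Q where "Q = cbox (Complex (-(e/2)) (-R)) (Complex 0 R)"
  have Q: "z \<in> Q \<longleftrightarrow> -(e/2) \<le> Re z \<and> Re z \<le> 0 \<and> \<bar>Im z\<bar> \<le> R" for z
    by (auto simp: Q_def in_cbox_complex_iff)
  have normQ: "norm z < R + 1" if "z \<in> Q" for z
    using that cmod_le[of z] e by (auto simp: Q)
  have QD: "Q \<subseteq> D"
    using normQ e by (auto simp: D_def Q)
  have "compact (G ` Q)"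
    using hol QD D(4) by (intro compact_continuous_image) (auto simp: Q_def intro!: holomorphic_on_imp_continuous_on holomorphic_on_subset[OF hol])
  then obtain M where M: "M > 0" "\<And>z. z \<in> Q \<Longrightarrow> norm (G z) \<le> M"
    by (auto dest!: compact_imp_bounded simp: bounded_pos)
  define c where "c = 1 / R + (R + 1) / R\<^sup>2"
  have c: "c > 0" using R by (auto simp: c_def intro!: add_pos_pos divide_pos_pos)
  \<comment> \<open>The horizontal sides contribute at most \<open>2 d M c\<close> whatever \<open>N\<close> is, so the box is made narrow
    first; the vertical side is then beaten by \<open>N powr (-d)\<close>.\<close>
  define d where "d = min (e / 2) (\<eta> / (M * c))"
  have d: "d > 0" "d \<le> e / 2" "d * (M * c) \<le> \<eta>"
    using e \<eta> M c by (auto simp: d_def min_def field_simps)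
  define c2 where "c2 = 1 / d + (R + 1) / R\<^sup>2"
  have c2: "c2 > 0" using R d by (auto simp: c2_def intro!: add_pos_pos divide_pos_pos)
  have "(\<lambda>N. R * (M * real N powr (-d) * c2)) \<longlonglongrightarrow> 0"
    using d by real_asymp
  then have ev: "\<forall>\<^sub>F N in sequentially. R * (M * real N powr (-d) * c2) < \<eta>"
    using \<eta> by (rule order_tendstoD)
  show ?thesis
    using ev eventually_gt_at_top[of 0]
  proof eventually_elim
    case (elim N)
    have N: "N > 0" and small: "R * (M * real N powr (-d) * c2) < \<eta>" using elim by auto
    let ?A = "part_circlepath 0 R (-(pi/2)) (pi/2)" and ?B = "box_path d R"
    let ?L = "part_circlepath 0 R (pi/2) (3*pi/2)"
    let ?k = "\<lambda>z. of_nat N powr z * newman_kernel R z"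
    let ?S = "dirichlet_psum a N"
    define f where "f z = (G z - ?S z) * of_nat N powr z * (1 + z\<^sup>2 / of_real R ^ 2)" for z
    have fk: "f z / z = (G z - ?S z) * of_nat N powr z * newman_kernel R z" for z
      by (simp add: f_def newman_kernel_def)
    have f0: "f 0 = G 0 - ?S 0" using N by (simp add: f_def)
    have holf: "f holomorphic_on D"
      unfolding f_def using N R
      by (intro holomorphic_intros holomorphic_on_subset[OF hol D(4)] holomorphic_dirichlet_psum) auto
    have imA: "path_image ?A \<subseteq> D"
      using right_half_circle[OF R] e R by (fastforce simp: D_def)
    have imB: "path_image ?B \<subseteq> Q"
      using d R by (auto simp: path_image_box_path Q)
    have imBD: "path_image ?B \<subseteq> D" using imB QD by blast
    note cau = cauchy_half_circle_box[OF d(1) R D(1,2,3) holf imA imBD, unfolded fk f0]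
    have holS: "(\<lambda>z. ?S z * of_nat N powr z * newman_kernel R z) holomorphic_on (- {z. Im z = 0 \<and> Re z \<ge> 0})"
      unfolding newman_kernel_def using N R
      by (intro holomorphic_intros holomorphic_dirichlet_psum) auto
    note box = box_path_eq_left_half_circle[OF d(1) R holS]
    have intG: "(\<lambda>z. G z * of_nat N powr z * newman_kernel R z) contour_integrable_on ?B"
      and sumB: "contour_integral ?B (\<lambda>z. (G z - ?S z) * of_nat N powr z * newman_kernel R z)
        = contour_integral ?B (\<lambda>z. G z * of_nat N powr z * newman_kernel R z)
        - contour_integral ?B (\<lambda>z. ?S z * of_nat N powr z * newman_kernel R z)"
    proof -
      have "(\<lambda>z. (G z - ?S z) * of_nat N powr z * newman_kernel R z + ?S z * of_nat N powr z * newman_kernel R z) contour_integrable_on ?B"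
        by (intro contour_integrable_add cau box)
      then show *: "(\<lambda>z. G z * of_nat N powr z * newman_kernel R z) contour_integrable_on ?B"
        by (simp add: algebra_simps)
      have "(\<lambda>z. (G z - ?S z) * of_nat N powr z * newman_kernel R z) =
        (\<lambda>z. G z * of_nat N powr z * newman_kernel R z - ?S z * of_nat N powr z * newman_kernel R z)"
        by (simp add: algebra_simps)
      then show "contour_integral ?B (\<lambda>z. (G z - ?S z) * of_nat N powr z * newman_kernel R z)
        = contour_integral ?B (\<lambda>z. G z * of_nat N powr z * newman_kernel R z)
        - contour_integral ?B (\<lambda>z. ?S z * of_nat N powr z * newman_kernel R z)"
        using contour_integral_diff[OF * box(2)] by simp
    qed
    have bA: "norm (contour_integral ?A (\<lambda>z. (G z - ?S z) * of_nat N powr z * newman_kernel R z)) \<le> 2 * pi * (C / R)"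
      by (rule newman_right_arc_bound[OF bd N R s cau(2)])
    have bL: "norm (contour_integral ?L (\<lambda>z. ?S z * of_nat N powr z * newman_kernel R z)) \<le> 2 * pi * (C / R + C / N)"
      by (rule newman_left_arc_bound[OF bd N R box(3)])
    have "norm (contour_integral ?B (\<lambda>z. G z * of_nat N powr z * newman_kernel R z)) \<le>
        2 * d * (M * c) + 2 * R * (M * real N powr (-d) * c2)"
    proof (rule contour_integral_box_path_bound[OF d(1) R intG])
      fix z assume z: "\<bar>Im z\<bar> = R" "-d \<le> Re z" "Re z \<le> 0"
      then have zQ: "z \<in> Q" using d by (auto simp: Q)
      have "norm (newman_kernel R z) \<le> c"
        unfolding c_def using normQ[OF zQ] abs_Im_le_cmod[of z] z R by (intro norm_newman_kernel_le) auto
      moreover have "real N powr Re z \<le> 1"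
        using powr_mono[of "Re z" 0 "real N"] z N by simp
      ultimately have "norm (G z) * real N powr Re z * norm (newman_kernel R z) \<le> M * 1 * c"
        using M(1) M(2)[OF zQ] by (intro mult_mono) auto
      then show "norm (G z * of_nat N powr z * newman_kernel R z) \<le> M * c"
        by (simp add: norm_mult)
    next
      fix z assume z: "Re z = -d" "\<bar>Im z\<bar> \<le> R"
      then have zQ: "z \<in> Q" using d by (auto simp: Q)
      have "norm (newman_kernel R z) \<le> c2"
        unfolding c2_def using normQ[OF zQ] abs_Re_le_cmod[of z] z R d by (intro norm_newman_kernel_le) auto
      then have "norm (G z) * real N powr Re z * norm (newman_kernel R z) \<le> M * real N powr (-d) * c2"
        using M(1) M(2)[OF zQ] z by (intro mult_mono) auto
      then show "norm (G z * of_nat N powr z * newman_kernel R z) \<le> M * real N powr (-d) * c2"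
        by (simp add: norm_mult)
    qed (use M c c2 in auto)
    also have "\<dots> \<le> 2 * pi * \<eta>"
    proof -
      have "2 * d * (M * c) \<le> 2 * \<eta>" using d(3) by (simp add: mult.assoc)
      moreover have "2 * R * (M * real N powr (-d) * c2) \<le> 2 * \<eta>" using small by (simp add: mult.assoc)
      moreover have "2 * \<eta> \<le> pi * \<eta>" using pi_ge_two \<eta> by (intro mult_right_mono) auto
      ultimately show ?thesis by linarith
    qed
    finally have bB: "norm (contour_integral ?B (\<lambda>z. G z * of_nat N powr z * newman_kernel R z)) \<le> 2 * pi * \<eta>" .
    have "2 * pi * norm (G 0 - ?S 0) = norm (2 * pi * \<i> * (G 0 - ?S 0))"
      by (simp add: norm_mult)
    also have "2 * pi * \<i> * (G 0 - ?S 0) =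
       contour_integral ?A (\<lambda>z. (G z - ?S z) * of_nat N powr z * newman_kernel R z)
       + contour_integral ?B (\<lambda>z. G z * of_nat N powr z * newman_kernel R z)
       - contour_integral ?L (\<lambda>z. ?S z * of_nat N powr z * newman_kernel R z)"
      using cau(1)[unfolded sumB box(1)] by (simp add: add_diff_eq)
    also have "norm \<dots> \<le> 2 * pi * (C / R) + 2 * pi * \<eta> + 2 * pi * (C / R + C / N)"
      by (intro norm_triangle_le_diff add_mono norm_triangle_le bA bB bL)
    also have "\<dots> = 2 * pi * (2 * C / R + C / N + \<eta>)" by (simp add: algebra_simps)
    finally show ?case by simp
  qed
qed

text \<open>
  Newman's Tauberian theorem: letting \<open>N\<close> and then the radius \<open>R\<close> tend to infinity in the
  estimate above gives the convergence at the boundary point.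
\<close>

theorem newman_tauberian:
  fixes a :: "nat \<Rightarrow> complex"
  assumes bd: "\<And>n. norm (a n) \<le> C"
    and U: "open U" "{z. Re z \<ge> 1} \<subseteq> U" and hol: "F holomorphic_on U"
    and s: "\<And>z. Re z > 1 \<Longrightarrow> (\<lambda>n. a n * of_nat n powr (-z)) sums F z"
  shows "(\<lambda>N. \<Sum>n=1..N. a n / of_nat n) \<longlonglongrightarrow> F 1"
proof -
  have C: "C \<ge> 0" using order.trans[OF norm_ge_zero bd[of 0]] .
  define W where "W = (\<lambda>z. 1 + z) -` U"
  define G where "G z = F (1 + z)" for z
  have "1 + z \<in> U" if "Re z \<ge> 0" for z using subsetD[OF U(2), of "1 + z"] that by simp
  then have W: "open W" "{z. Re z \<ge> 0} \<subseteq> W"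
    using U(1) unfolding W_def by (auto intro!: open_vimage continuous_intros)
  have holG: "G holomorphic_on W"
  proof -
    have "(\<lambda>z. 1 + z) holomorphic_on W" by (intro holomorphic_intros)
    moreover have "(\<lambda>z. 1 + z) ` W \<subseteq> U" by (auto simp: W_def)
    ultimately show ?thesis
      using holomorphic_on_compose_gen[OF _ hol] unfolding G_def o_def by blast
  qed
  have sG: "(\<lambda>n. a n * of_nat n powr (-1 - z)) sums G z" if "Re z > 0" for z
  proof -
    have e: "-(1 + z) = -1 - z" by simp
    show ?thesis using s[of "1 + z", unfolded e] that by (simp add: G_def)
  qed
  have "(\<lambda>N. dirichlet_psum a N 0) \<longlonglongrightarrow> G 0"
  proof (rule tendstoI)
    fix \<epsilon> :: real assume \<epsilon>: "\<epsilon> > 0"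
    \<comment> \<open>Adding 1 to \<open>C\<close> keeps \<open>R\<close> positive when \<open>C = 0\<close>.\<close>
    define R where "R = 8 * (C + 1) / \<epsilon>"
    have R: "R > 0" using C \<epsilon> by (simp add: R_def)
    have RC: "2 * C / R \<le> \<epsilon> / 4" using C \<epsilon> by (simp add: R_def field_simps)
    have "(\<lambda>N. C / real N) \<longlonglongrightarrow> 0" by real_asymp
    then have "\<forall>\<^sub>F N in sequentially. C / real N < \<epsilon> / 4"
      using \<epsilon> by (intro order_tendstoD) auto
    moreover have "\<forall>\<^sub>F N in sequentially. norm (G 0 - dirichlet_psum a N 0) \<le> 2 * C / R + C / N + \<epsilon> / 4"
      using \<epsilon> by (intro newman_estimate[OF bd W holG sG R]) auto
    ultimately show "\<forall>\<^sub>F N in sequentially. dist (dirichlet_psum a N 0) (G 0) < \<epsilon>"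
    proof eventually_elim
      case (elim N)
      then have "norm (G 0 - dirichlet_psum a N 0) < \<epsilon>" using RC \<epsilon> by linarith
      then show ?case by (simp add: dist_norm norm_minus_commute)
    qed
  qed
  then show ?thesis
    by (simp add: dirichlet_psum_def G_def powr_minus divide_inverse)
qed


section \<open>Chebyshev's estimate\<close>

definition chebyshev_psi :: "nat \<Rightarrow> real" where
  "chebyshev_psi n = (\<Sum>d=1..n. mangoldt d)"

lemma chebyshev_psi_mono: "m \<le> n \<Longrightarrow> chebyshev_psi m \<le> chebyshev_psi n"
  unfolding chebyshev_psi_def by (intro sum_mono2) (auto simp: mangoldt_nonneg)

lemma chebyshev_psi_nonneg: "chebyshev_psi n \<ge> 0"
  unfolding chebyshev_psi_def by (intro sum_nonneg mangoldt_nonneg)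

lemma chebyshev_psi_Suc: "chebyshev_psi (Suc n) = chebyshev_psi n + mangoldt (Suc n)"
  by (simp add: chebyshev_psi_def)

lemma card_multiples: 
  assumes "d > 0"
  shows "card {m \<in> {1..x}. d dvd m} = x div (d::nat)"
proof -
  have "{m \<in> {1..x}. d dvd m} = (\<lambda>i. d * i) ` {1..x div d}"
  proof (intro equalityI subsetI)
    fix m assume "m \<in> {m \<in> {1..x}. d dvd m}"
    then obtain i where i: "m = d * i" "1 \<le> m" "m \<le> x" by auto
    then have "i \<le> x div d" using assms by (simp add: less_eq_div_iff_mult_less_eq mult.commute)
    moreover have "1 \<le> i" using i by (cases i) auto
    ultimately show "m \<in> (\<lambda>i. d * i) ` {1..x div d}" using i by auto
  next
    fix m assume "m \<in> (\<lambda>i. d * i) ` {1..x div d}"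
    then obtain i where "m = d * i" "i \<in> {1..x div d}" by blast
    then have i: "m = d * i" "1 \<le> i" "i \<le> x div d" by auto
    then have "d * i \<le> x" using assms by (simp add: less_eq_div_iff_mult_less_eq mult.commute)
    moreover have "1 \<le> d * i" using i assms by (simp add: Suc_le_eq)
    ultimately show "m \<in> {m \<in> {1..x}. d dvd m}" using i by auto
  qed
  also have "card \<dots> = x div d"
    using assms by (subst card_image) (auto simp: inj_on_def)
  finally show ?thesis .
qed

text \<open>
  Sum \<open>ln m = \<Sum>\<^bsub>d dvd m\<^esub> \<Lambda>(d)\<close> over \<open>m\<close> and count the multiples of each \<open>d\<close>. The freedom in
  \<open>y\<close> allows sums for different \<open>x\<close> to be combined over a common range.
\<close>

lemma sum_ln_eq_sum_mangoldt:
  assumes "x \<le> y"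
  shows "(\<Sum>m=1..x. ln (real m)) = (\<Sum>d=1..y. mangoldt d * real (x div d))"
proof -
  have "(\<Sum>m=1..x. ln (real m)) = (\<Sum>m=1..x. \<Sum>d\<in>{d \<in> {1..y}. d dvd m}. mangoldt d)"
  proof (rule sum.cong)
    fix m assume m: "m \<in> {1..x}"
    then have "{d \<in> {1..y}. d dvd m} = {d. d dvd m}"
      using assms by (auto dest: dvd_imp_le intro!: Suc_leI Nat.gr0I)
    then show "ln (real m) = (\<Sum>d\<in>{d \<in> {1..y}. d dvd m}. mangoldt d)"
      using mangoldt_sum[of m, where 'a = real] m by simp
  qed auto
  also have "\<dots> = (\<Sum>d=1..y. \<Sum>m\<in>{m \<in> {1..x}. d dvd m}. mangoldt d)"
    by (rule sum.swap_restrict) auto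
  also have "\<dots> = (\<Sum>d=1..y. mangoldt d * real (x div d))"
  proof (rule sum.cong)
    fix d assume "d \<in> {1..y}"
    then have "card {m \<in> {1..x}. d dvd m} = x div d" by (intro card_multiples) auto
    then show "(\<Sum>m\<in>{m \<in> {1..x}. d dvd m}. mangoldt d) = mangoldt d * real (x div d)"
      by (simp only: sum_constant mult.commute)
  qed auto
  finally show ?thesis .
qed

lemma sum_ln_eq_ln_fact: "(\<Sum>m=1..n. ln (real m)) = ln (fact n)"
proof (induction n)
  case (Suc n)
  then show ?case by (simp add: ln_mult)
qed auto

text \<open>
  Chebyshev's argument: \<open>\<psi>(2n) - \<psi>(n)\<close> is part of the logarithm of the central binomial
  coefficient, which is at most \<open>2n ln 2\<close>.
\<close>

lemma chebyshev_psi_double: "chebyshev_psi (2 * n) - chebyshev_psi n \<le> 2 * n"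
proof -
  have "chebyshev_psi (2 * n) - chebyshev_psi n = (\<Sum>d\<in>{1..2*n} - {1..n}. mangoldt d)"
    unfolding chebyshev_psi_def by (subst sum_diff) auto
  also have "\<dots> = (\<Sum>d=1..2*n. mangoldt d * (if n < d then 1 else 0))"
    by (intro sum.mono_neutral_cong_left) auto
  also have "\<dots> \<le> (\<Sum>d=1..2*n. mangoldt d * (real (2 * n div d) - 2 * real (n div d)))"
  proof (intro sum_mono mult_left_mono mangoldt_nonneg)
    fix d assume d: "d \<in> {1..2*n}"
    have "2 * (n div d) \<le> 2 * n div d"
      using d by (simp add: less_eq_div_iff_mult_less_eq)
    moreover have "2 * n div d \<ge> 1" using d by (simp add: less_eq_div_iff_mult_less_eq)
    moreover have "n div d = 0" if "n < d" using that by simp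
    ultimately show "(if n < d then 1 else 0) \<le> real (2 * n div d) - 2 * real (n div d)"
      by (auto simp flip: of_nat_mult)
  qed
  also have "\<dots> = ln (fact (2 * n)) - 2 * ln (fact n)"
    using sum_ln_eq_sum_mangoldt[of "2*n" "2*n"] sum_ln_eq_sum_mangoldt[of n "2*n"]
    by (simp add: algebra_simps sum_subtractf sum_distrib_left sum_ln_eq_ln_fact[symmetric])
  also have "\<dots> = ln (real (2 * n choose n))"
  proof -
    have "real (2 * n choose n) = fact (2 * n) / (fact n * fact n)"
      using binomial_fact[of n "2 * n", where 'a = real] by simp
    then show ?thesis by (simp add: ln_div ln_mult)
  qed
  also have "\<dots> \<le> ln (2 ^ (2 * n))"
  proof -
    have "real (2 * n choose n) \<le> 2 ^ (2 * n)"
      using binomial_le_pow2[of "2*n" n] by (metis of_nat_le_iff of_nat_numeral of_nat_power)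
    then show ?thesis by (subst ln_le_cancel_iff) auto
  qed
  also have "\<dots> = real (2 * n) * ln 2" by (subst ln_realpow) auto
  also have "\<dots> \<le> real (2 * n) * 1"
    using ln_le_minus_one[of 2] by (intro mult_left_mono) auto
  finally show ?thesis by simp
qed

text \<open>
  Repeated halving turns the previous bound into a geometric series; an odd argument costs an
  extra logarithm.
\<close>

lemma chebyshev_psi_le: "chebyshev_psi n \<le> 4 * n"
proof (induction n rule: less_induct)
  case (less n)
  consider "n = 0" | m where "n = 2 * m" "m > 0" | m where "n = Suc (2 * m)"
    by (metis evenE oddE gr0I mult_0_right Suc_eq_plus1)
  then show ?case
  proof cases
    case 1
    then show ?thesis by (simp add: chebyshev_psi_def)
  next
    case 2
    then show ?thesis using less.IH[of m] chebyshev_psi_double[of m] by simp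
  next
    case 3
    have "chebyshev_psi n \<le> chebyshev_psi (2 * m) + ln (real n)"
      using mangoldt_le[of "Suc (2 * m)"] 3 by (simp add: chebyshev_psi_Suc)
    also have "ln (real n) \<le> 2 * m" using ln_le_minus_one[of "real n"] 3 by simp
    also have "chebyshev_psi (2 * m) \<le> chebyshev_psi m + 2 * m"
      using chebyshev_psi_double[of m] by simp
    also have "chebyshev_psi m \<le> 4 * m" using 3 by (intro less.IH) auto
    finally show ?thesis using 3 by simp
  qed
qed

section \<open>From the error sum to primes in intervals\<close>

text \<open>
  A prime power \<open>p\<^sup>j \<le> k\<close> with \<open>j \<ge> 2\<close> has \<open>p \<le> sqrt k\<close> and \<open>j \<le> log 2 k\<close>, and its weight is at
  most \<open>ln k\<close>. So \<open>\<psi>\<close> can grow on a long interval only through primes.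
\<close>

lemma sum_mangoldt_proper_prime_powers_le:
  assumes "k > 0" "A \<subseteq> {1..k}" "\<And>p. p \<in> A \<Longrightarrow> \<not> prime p"
  shows "(\<Sum>m\<in>A. mangoldt m) \<le> sqrt k * log 2 k * ln k"
proof -
  define P where "P = {m \<in> A. primepow m}"
  have fin: "finite A" using assms(2) finite_subset by blast
  define B where "B = {1..nat \<lfloor>sqrt k\<rfloor>} \<times> {1..nat \<lfloor>log 2 k\<rfloor>}"
  have "P \<subseteq> (\<lambda>(p, j). p ^ j) ` B"
  proof
    fix m assume m: "m \<in> P"
    then obtain p j where p: "prime p" "j > 0" "m = p ^ j" by (auto simp: P_def primepow_def)
    have mk: "m \<le> k" "m \<in> A" using m assms(2) by (auto simp: P_def)
    have "j \<noteq> 1" using assms(3)[OF mk(2)] p by auto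
    then have j: "2 \<le> j" using p by auto
    have p2: "p \<ge> 2" using p prime_ge_2_nat by auto
    have "p ^ 2 \<le> m" unfolding p(3) using p2 j by (intro power_increasing) auto
    then have "real p ^ 2 \<le> real k" using mk by (metis of_nat_le_iff of_nat_power order.trans)
    then have "real p \<le> sqrt k" by (rule real_le_rsqrt)
    then have "p \<le> nat \<lfloor>sqrt k\<rfloor>" by (simp add: le_nat_floor)
    moreover have "2 ^ j \<le> m" unfolding p(3) using p2 by (rule power_mono) auto
    then have "(2::real) ^ j \<le> real k" using mk by (metis of_nat_le_iff of_nat_power of_nat_numeral order.trans)
    then have "real j \<le> log 2 k" using assms(1) by (simp add: le_log_iff powr_realpow)
    then have "j \<le> nat \<lfloor>log 2 k\<rfloor>" by (simp add: le_nat_floor)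
    ultimately have "(p, j) \<in> B" using p2 j by (auto simp: B_def)
    then show "m \<in> (\<lambda>(p, j). p ^ j) ` B" using p by force
  qed
  then have "card P \<le> card B"
    by (metis B_def card_image_le card_mono finite_SigmaI finite_atLeastAtMost finite_imageI order.trans)
  also have "\<dots> = nat \<lfloor>sqrt k\<rfloor> * nat \<lfloor>log 2 k\<rfloor>" by (simp add: B_def)
  finally have "real (card P) \<le> real (nat \<lfloor>sqrt k\<rfloor>) * real (nat \<lfloor>log 2 k\<rfloor>)"
    by (metis of_nat_le_iff of_nat_mult)
  also have "\<dots> \<le> sqrt k * log 2 k"
    using assms(1) by (intro mult_mono of_nat_floor) auto
  finally have c: "real (card P) \<le> sqrt k * log 2 k" .
  have "(\<Sum>m\<in>A. mangoldt m) = (\<Sum>m\<in>P. mangoldt m)"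
    unfolding P_def using fin by (intro sum.mono_neutral_right) (auto simp: mangoldt_def)
  also have "\<dots> \<le> real (card P) * ln k"
  proof (rule sum_bounded_above)
    fix m assume "m \<in> P"
    then have "m \<in> {1..k}" using assms by (auto simp: P_def)
    then show "mangoldt m \<le> ln (real k)"
      using mangoldt_le[of m] by (smt (verit) atLeastAtMost_iff ln_le_cancel_iff of_nat_0_less_iff of_nat_le_iff zero_less_one le_trans less_le_trans)
  qed
  also have "\<dots> \<le> sqrt k * log 2 k * ln k"
    using assms(1) by (intro mult_right_mono c) auto
  finally show ?thesis .
qed


lemma sum_atLeastAtMost_split:
  assumes "A \<le> (B::nat)"
  shows "sum f {1..B} = sum f {1..A} + sum f {A<..B}"
proof -
  have "{1..B} = {1..A} \<union> {A<..B}" using assms by auto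
  then show ?thesis by (simp only:) (rule sum.union_disjoint, auto)
qed

text \<open>
  Suppose there is no prime in \<open>[(1 - \<delta>) k, k]\<close>. Then \<open>\<psi>\<close> is constant there up to an error
  \<open>o(k)\<close>, while \<open>n\<close> varies by \<open>\<delta> k\<close>. If \<open>\<psi>(k)\<close> is below the midpoint of the interval, then
  \<open>\<psi>(n) - n\<close> is at most \<open>-\<delta> k/4\<close> in the last quarter; otherwise it is at least \<open>\<delta> k/8\<close> in the
  first quarter. Both contradict the Cauchy criterion for \<open>\<Sum> (\<psi>(n) - n)/n\<^sup>2\<close>.
\<close>

lemma prime_in_interval_of_psi_convergent:
  fixes \<delta> :: real
  assumes conv: "convergent (\<lambda>N. \<Sum>n=1..N. (chebyshev_psi n / n - 1) / n)"
    and \<delta>: "0 < \<delta>" "\<delta> < 1"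
  shows "\<forall>\<^sub>F k in sequentially. \<exists>p. prime p \<and> (1 - \<delta>) * k \<le> p \<and> p \<le> k"
proof -
  let ?t = "\<lambda>n::nat. (chebyshev_psi n / n - 1) / n"
  define s where "s N = (\<Sum>n=1..N. ?t n)" for N :: nat
  have "Cauchy s" using conv Cauchy_convergent_iff unfolding s_def by blast
  then obtain N0 where N0: "\<And>m n. m \<ge> N0 \<Longrightarrow> n \<ge> N0 \<Longrightarrow> \<bar>s m - s n\<bar> < \<delta>\<^sup>2 / 64"
    using \<delta> by (metis CauchyD divide_pos_pos real_norm_def zero_less_numeral zero_less_power)
  have s_diff: "s B - s A = (\<Sum>n\<in>{A<..B}. ?t n)" if "A \<le> B" for A B
    using sum_atLeastAtMost_split[OF that, of ?t] unfolding s_def by simp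
  have "\<forall>\<^sub>F k::nat in sequentially. sqrt k * log 2 k * ln k \<le> \<delta> / 8 * k"
    using \<delta> by real_asymp
  moreover have "\<forall>\<^sub>F k::nat in sequentially. (1 - \<delta>) * k \<ge> N0" using \<delta> by real_asymp
  moreover have "\<forall>\<^sub>F k::nat in sequentially. \<delta> * k \<ge> 16" using \<delta> by real_asymp
  ultimately show ?thesis using eventually_gt_at_top[of 0]
  proof eventually_elim
    case (elim k)
    show ?case
    proof (rule ccontr)
      assume noprime: "\<not> (\<exists>p. prime p \<and> (1 - \<delta>) * k \<le> p \<and> p \<le> k)"
      have k: "real k > 0" using elim by simp
      have lower: "chebyshev_psi n \<ge> chebyshev_psi k - \<delta> / 8 * k" if n: "(1 - \<delta>) * k \<le> n" "n \<le> k" for n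
      proof -
        have "chebyshev_psi k = chebyshev_psi n + (\<Sum>m\<in>{n<..k}. mangoldt m)"
          unfolding chebyshev_psi_def by (rule sum_atLeastAtMost_split) (use n in simp)
        also have "(\<Sum>m\<in>{n<..k}. mangoldt m) \<le> sqrt k * log 2 k * ln k"
        proof (rule sum_mangoldt_proper_prime_powers_le)
          fix p assume p: "p \<in> {n<..k}"
          then have "real n \<le> real p" by simp
          then show "\<not> prime p" using noprime n p by force
        qed (use elim in auto)
        finally show ?thesis using elim(1) by simp
      qed
      show False
      proof (cases "chebyshev_psi k \<le> (1 - \<delta> / 2) * k")
        case True
        define A where "A = nat \<lceil>(1 - \<delta> / 4) * k\<rceil>"
        have pos: "(1 - \<delta> / 4) * k \<ge> 0" using \<delta> by simp
        have A: "(1 - \<delta> / 4) * k \<le> A" "A \<le> (1 - \<delta> / 4) * k + 1"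
          using pos unfolding A_def by linarith+
        have Ak: "real A \<le> k" using A elim(3) \<delta> by (simp add: algebra_simps)
        have AN: "A \<ge> N0"
        proof -
          have "(1 - \<delta>) * k \<le> (1 - \<delta> / 4) * k" using \<delta> by (intro mult_right_mono) auto
          then show ?thesis using A elim(2) by linarith
        qed
        have "(\<Sum>n\<in>{A<..k}. ?t n) \<le> real (card {A<..k}) * (- (\<delta> / 4) / k)"
        proof (rule sum_bounded_above)
          fix n assume n: "n \<in> {A<..k}"
          then have nA: "real A \<le> n" "real n \<le> k" "real n > 0" by auto
          have "chebyshev_psi n \<le> chebyshev_psi k" using n by (intro chebyshev_psi_mono) auto
          then have "chebyshev_psi n - n \<le> - (\<delta> / 4) * k"
            using True A nA by (simp add: algebra_simps)
          also have "\<dots> \<le> - (\<delta> / 4) * n" using nA \<delta> by simp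
          finally have "(chebyshev_psi n - n) / n \<le> - (\<delta> / 4)"
            using nA by (simp add: field_simps)
          then have "?t n \<le> - (\<delta> / 4) / n" using nA
            by (intro divide_right_mono) (simp_all add: diff_divide_distrib)
          also have "\<dots> \<le> - (\<delta> / 4) / k" using nA \<delta> by (simp add: frac_le)
          finally show "?t n \<le> - (\<delta> / 4) / k" .
        qed
        also have "\<dots> = - (real (card {A<..k}) * ((\<delta> / 4) / k))" by simp
        also have "\<dots> \<le> - ((\<delta> / 8 * k) * ((\<delta> / 4) / k))"
        proof -
          have "real (card {A<..k}) \<ge> \<delta> / 8 * k"
            using A Ak elim(3) by (simp add: of_nat_diff algebra_simps)
          then show ?thesis using \<delta> k by (intro le_imp_neg_le mult_right_mono) auto
        qed
        also have "\<dots> = - (\<delta>\<^sup>2 / 32)" using k by (simp add: power2_eq_square)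
        finally have "s k - s A \<le> - (\<delta>\<^sup>2 / 32)" using s_diff[of A k] Ak by simp
        moreover have "\<bar>s k - s A\<bar> < \<delta>\<^sup>2 / 64" using AN Ak by (intro N0) auto
        moreover have "\<delta>\<^sup>2 \<ge> 0" by simp
        ultimately show False by linarith
      next
        case False
        define A where "A = nat \<lceil>(1 - \<delta>) * k\<rceil>"
        define B where "B = nat \<lfloor>(1 - 3 * \<delta> / 4) * k\<rfloor>"
        have pos: "(1 - \<delta>) * k \<ge> 0" "(1 - 3 * \<delta> / 4) * k \<ge> 0" using \<delta> by simp_all
        have A: "(1 - \<delta>) * k \<le> A" "A \<le> (1 - \<delta>) * k + 1"
          using pos unfolding A_def by linarith+
        have B: "B \<le> (1 - 3 * \<delta> / 4) * k" "(1 - 3 * \<delta> / 4) * k \<le> B + 1"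
          using pos unfolding B_def by linarith+
        have AB: "real B - real A \<ge> \<delta> / 8 * k"
          using A B elim(3) by (simp add: algebra_simps)
        then have AB': "A \<le> B" using \<delta> k by (smt (verit) mult_pos_pos divide_pos_pos of_nat_le_iff)
        have Bk: "real B \<le> k"
        proof -
          have "(1 - 3 * \<delta> / 4) * k \<le> 1 * real k" using \<delta> by (intro mult_right_mono) auto
          then show ?thesis using B by linarith
        qed
        have AN: "A \<ge> N0" using A elim(2) by linarith
        have "real (card {A<..B}) * (\<delta> / 8 / k) \<le> (\<Sum>n\<in>{A<..B}. ?t n)"
        proof (rule sum_bounded_below)
          fix n assume n: "n \<in> {A<..B}"
          then have nA: "real A \<le> n" "real n \<le> B" "real n > 0" by auto
          have nk: "real n \<le> k" using nA Bk by linarith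
          have "chebyshev_psi n \<ge> chebyshev_psi k - \<delta> / 8 * k"
            using nA A nk by (intro lower) auto
          then have "chebyshev_psi n - n \<ge> \<delta> / 8 * k"
            using False B nA by (simp add: algebra_simps)
          moreover have "\<delta> / 8 * k \<ge> \<delta> / 8 * n" using nk \<delta> by simp
          ultimately have "chebyshev_psi n - n \<ge> \<delta> / 8 * n" by linarith
          then have "(chebyshev_psi n - n) / n \<ge> \<delta> / 8"
            using nA by (simp add: field_simps)
          then have "?t n \<ge> \<delta> / 8 / n" using nA
            by (intro divide_right_mono) (simp_all add: diff_divide_distrib)
          moreover have "\<delta> / 8 / k \<le> \<delta> / 8 / n" using nA nk \<delta> by (intro divide_left_mono) auto
          ultimately show "\<delta> / 8 / k \<le> ?t n" by linarith
        qed
        moreover have "real (card {A<..B}) * (\<delta> / 8 / k) \<ge> (\<delta> / 8 * k) * (\<delta> / 8 / k)"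
          using AB AB' \<delta> k by (intro mult_right_mono) (auto simp: of_nat_diff)
        moreover have "(\<delta> / 8 * k) * (\<delta> / 8 / k) = \<delta>\<^sup>2 / 64" using k by (simp add: power2_eq_square)
        ultimately have "s B - s A \<ge> \<delta>\<^sup>2 / 64" using s_diff[OF AB'] by simp
        moreover have "\<bar>s B - s A\<bar> < \<delta>\<^sup>2 / 64" using AN AB' by (intro N0) auto
        ultimately show False by linarith
      qed
    qed
  qed
qed


section \<open>Continuation of the zeta function\<close>

lemma of_nat_powr_complex: "n > 0 \<Longrightarrow> (of_nat n :: complex) powr z = exp (z * of_real (ln (real n)))"
  by (simp add: powr_def)

text \<open>
  Minus the first-order Taylor remainder at \<open>n\<close> of \<open>t powr (-z)\<close> on a step of length 1. Summed
  against coefficients it compares a telescoping series with the series of \<open>z n powr (-1 - z)\<close>,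
  and it decays faster by one power of \<open>n\<close>; this gives all analytic continuations below.
\<close>

definition power_remainder :: "nat \<Rightarrow> complex \<Rightarrow> complex" where
  "power_remainder n z = of_nat n powr (-z) - of_nat (Suc n) powr (-z) - z * of_nat n powr (-1 - z)"

lemma holomorphic_power_remainder: "power_remainder n holomorphic_on A"
  unfolding power_remainder_def[abs_def] by (intro holomorphic_intros)

lemma norm_power_remainder_le:
  assumes n: "n > 0" and z: "Re z \<ge> -2"
  shows "norm (power_remainder n z) \<le> norm z * norm (z + 1) * real n powr (-2 - Re z)"
proof -
  define S where "S = closed_segment (of_nat n) (of_nat (Suc n) :: complex)"
  define f :: "nat \<Rightarrow> complex \<Rightarrow> complex" where
    "f i t = (if i = 0 then t powr (-z) else if i = 1 then - z * t powr (-1 - z)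
              else z * (z + 1) * t powr (-2 - z))" for i t
  have S: "t \<in> \<real> \<and> Re t \<ge> real n" if "t \<in> S" for t
  proof -
    obtain u where u: "0 \<le> u" "t = (1 - u) *\<^sub>R of_nat n + u *\<^sub>R of_nat (Suc n)"
      using \<open>t \<in> S\<close> unfolding S_def closed_segment_def by auto
    then have "t = of_real (real n + u)" by (simp add: scaleR_conv_of_real algebra_simps)
    then show ?thesis using u(1) by auto
  qed
  have S': "t \<notin> \<real>\<^sub>\<le>\<^sub>0" if "t \<in> S" for t
    using S[OF that] n by (auto simp: complex_nonpos_Reals_iff)
  have "norm (f 0 (of_nat (Suc n)) - (\<Sum>i\<le>1. f i (of_nat n) * (of_nat (Suc n) - of_nat n) ^ i / fact i))
     \<le> (norm z * norm (z + 1) * real n powr (-2 - Re z)) * norm (of_nat (Suc n) - of_nat n :: complex) ^ Suc 1 / fact 1"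
  proof (rule complex_Taylor[of S])
    show "convex S" "of_nat n \<in> S" "of_nat (Suc n) \<in> S" by (auto simp: S_def)
  next
    fix i :: nat and t assume t: "t \<in> S" and "i \<le> 1"
    then consider "i = 0" | "i = 1" by linarith
    then show "(f i has_field_derivative f (Suc i) t) (at t within S)"
    proof cases
      case 1
      have "((\<lambda>t. t powr (-z)) has_field_derivative (-z) * t powr (-z - 1)) (at t within S)"
        using S'[OF t] by (intro has_field_derivative_at_within[OF has_field_derivative_powr])
      then show ?thesis using 1 by (simp add: f_def[abs_def] minus_diff_commute)
    next
      case 2
      have "((\<lambda>t. (-z) * t powr (-1 - z)) has_field_derivative (-z) * ((-1 - z) * t powr (-1 - z - 1))) (at t within S)"
        using S'[OF t] by (intro DERIV_cmult has_field_derivative_at_within[OF has_field_derivative_powr])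
      moreover have "-1 - z - 1 = -2 - z" by simp
      moreover have "(-z) * ((-1 - z) * c) = z * (z + 1) * c" for c by (simp add: algebra_simps)
      ultimately show ?thesis using 2 by (simp only: f_def[abs_def]) simp
    qed
  next
    fix t assume t: "t \<in> S"
    have "norm (t powr (-2 - z)) = Re t powr (-2 - Re z)"
      using S[OF t] n by (subst norm_powr_real_powr) auto
    also have "\<dots> \<le> real n powr (-2 - Re z)"
      using S[OF t] n z by (intro powr_mono2') auto
    finally show "norm (f (Suc 1) t) \<le> norm z * norm (z + 1) * real n powr (-2 - Re z)"
      by (simp add: f_def norm_mult mult_left_mono)
  qed
  also have "f 0 (of_nat (Suc n)) - (\<Sum>i\<le>1. f i (of_nat n) * (of_nat (Suc n) - of_nat n) ^ i / fact i) = - power_remainder n z"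
    by (simp add: f_def power_remainder_def)
  finally show ?thesis by simp
qed

text \<open>
  The gain of one power of \<open>n\<close> pushes the domain of convergence one unit to the left of that of
  the Dirichlet series \<open>\<Sum> c(n) n powr (-1 - z)\<close>.
\<close>

lemma power_remainder_series:
  fixes c :: "nat \<Rightarrow> complex"
  assumes c: "\<And>n. n > 0 \<Longrightarrow> norm (c n) \<le> C * real n powr \<beta>" and \<beta>: "\<beta> \<ge> 0"
  obtains g where "g holomorphic_on {z. Re z > \<beta> - 1}"
    "\<And>z. Re z > \<beta> - 1 \<Longrightarrow> (\<lambda>n. c n * power_remainder n z) sums g z"
proof -
  let ?H = "{z. Re z > \<beta> - 1}"
  have op: "open ?H" by (rule open_halfspace_Re_gt)
  have C: "C \<ge> 0" using order.trans[OF norm_ge_zero c[of 1]] by simp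
  have "\<exists>g g'. \<forall>x\<in>?H. (\<lambda>n. c n * power_remainder n x) sums g x
      \<and> (\<lambda>n. deriv (\<lambda>z. c n * power_remainder n z) x) sums g' x \<and> (g has_field_derivative g' x) (at x)"
  proof (rule series_and_derivative_comparison_local[OF op])
    fix n x assume "x \<in> ?H"
    show "((\<lambda>z. c n * power_remainder n z) has_field_derivative deriv (\<lambda>z. c n * power_remainder n z) x) (at x)"
      by (rule holomorphic_derivI[of _ UNIV]) (auto intro!: holomorphic_intros holomorphic_power_remainder)
  next
    fix x assume x: "x \<in> ?H"
    \<comment> \<open>Half the distance to the boundary: the exponent stays below \<open>-1\<close> by \<open>d\<close> on the whole disc.\<close>
    define d where "d = (Re x - (\<beta> - 1)) / 2"
    have d: "d > 0" using x by (simp add: d_def)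
    define r where "r = norm x + d"
    define h where "h n = C * (r * (r + 1)) * real n powr (-1 - d)" for n
    have "summable (\<lambda>n. real (n + Suc 1) powr (-1 - d))" by (rule powr_tail_bound[OF d]) simp
    then have "summable (\<lambda>n. real n powr (-1 - d))" by (rule summable_iff_shift[THEN iffD1])
    then have "summable h" unfolding h_def by (rule summable_mult)
    moreover have "\<forall>\<^sub>F n in sequentially. \<forall>y\<in>ball x d \<inter> ?H. norm (c n * power_remainder n y) \<le> h n"
      using eventually_gt_at_top[of 0]
    proof eventually_elim
      case (elim n)
      show ?case
      proof
        fix y assume y: "y \<in> ball x d \<inter> ?H"
        then have yx: "norm (x - y) < d" by (simp add: dist_norm)
        have "norm y \<le> r" using yx norm_triangle_ineq2[of y x] by (simp add: r_def norm_minus_commute)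
        then have ny: "norm y * norm (y + 1) \<le> r * (r + 1)"
          using norm_triangle_ineq[of y 1] order.trans[OF norm_ge_zero, of y r] by (intro mult_mono) auto
        have "Re x - Re y \<le> norm (x - y)" using complex_Re_le_cmod[of "x - y"] by simp
        then have Rey: "Re y \<ge> \<beta> - 1 + d" using yx by (simp add: d_def field_simps)
        have "norm (c n * power_remainder n y) \<le> (C * real n powr \<beta>) * (norm y * norm (y + 1) * real n powr (-2 - Re y))"
          unfolding norm_mult using Rey \<beta> d elim by (intro mult_mono c norm_power_remainder_le) (auto intro: order.trans[OF norm_ge_zero c])
        also have "\<dots> \<le> (C * real n powr \<beta>) * (r * (r + 1) * real n powr (-2 - (\<beta> - 1 + d)))"
        proof (rule mult_left_mono[OF mult_mono[OF ny]])
          show "real n powr (-2 - Re y) \<le> real n powr (-2 - (\<beta> - 1 + d))"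
            using Rey elim by (intro powr_mono) auto
          show "0 \<le> r * (r + 1)" by (rule order.trans[OF _ ny]) simp
        qed (use C in auto)
        also have "\<dots> = C * (r * (r + 1)) * (real n powr \<beta> * real n powr (-2 - (\<beta> - 1 + d)))" by simp
        also have "real n powr \<beta> * real n powr (-2 - (\<beta> - 1 + d)) = real n powr (-1 - d)"
          by (subst powr_add[symmetric]) (simp add: algebra_simps)
        finally show "norm (c n * power_remainder n y) \<le> h n" by (simp add: h_def)
      qed
    qed
    ultimately show "\<exists>d h. 0 < d \<and> summable h \<and> (\<forall>\<^sub>F n in sequentially. \<forall>y\<in>ball x d \<inter> ?H. norm (c n * power_remainder n y) \<le> h n)"
      using d by blast
  qed
  then obtain g g' where g: "\<And>x. x \<in> ?H \<Longrightarrow> (\<lambda>n. c n * power_remainder n x) sums g x"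
    "\<And>x. x \<in> ?H \<Longrightarrow> (g has_field_derivative g' x) (at x)" by blast
  have "g holomorphic_on ?H"
    using g(2) by (subst holomorphic_on_open[OF op]) blast
  then show ?thesis using g(1) that by blast
qed


text \<open>
  Rearrangement of the absolutely convergent double series along the products \<open>d m = n\<close>. The
  terms of index 0 are excluded, since every number divides 0.
\<close>

lemma dirichlet_product_sums:
  fixes f g :: "nat \<Rightarrow> complex"
  assumes f: "summable (\<lambda>n. norm (f n))" "f sums A" "f 0 = 0"
    and g: "summable (\<lambda>n. norm (g n))" "g sums B" "g 0 = 0"
  shows "(\<lambda>n. \<Sum>d | d dvd n. f d * g (n div d)) sums (A * B)"
proof -
  have fA: "(f has_sum A) UNIV" and gB: "(g has_sum B) UNIV"
    using f g by (auto intro: norm_summable_imp_has_sum)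
  have fa: "(\<lambda>d. norm (f d)) summable_on UNIV" and ga: "(\<lambda>m. norm (g m)) summable_on UNIV"
    using f(1) g(1) by (auto intro!: norm_summable_imp_summable_on)
  have "(\<lambda>p. norm (f (fst p) * g (snd p))) summable_on (UNIV \<times> UNIV)"
  proof (subst Infinite_Sum.abs_summable_on_Sigma_iff, intro conjI ballI)
    fix d :: nat
    show "(\<lambda>m. norm (f (fst (d, m)) * g (snd (d, m)))) summable_on UNIV"
      using ga by (simp add: norm_mult summable_on_cmult_right)
  next
    show "(\<lambda>d. norm (\<Sum>\<^sub>\<infinity>m. norm (f (fst (d, m)) * g (snd (d, m))))) summable_on UNIV"
      using fa ga by (simp add: norm_mult infsum_cmult_right' summable_on_cmult_left infsum_nonneg)
  qed
  then have "((\<lambda>p. f (fst p) * g (snd p)) has_sum (A * B)) (UNIV \<times> UNIV)"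
    by (intro has_sum_SigmaI[where g = "\<lambda>d. f d * B"])
      (auto intro: has_sum_cmult_right gB has_sum_cmult_left fA abs_summable_summable)
  also have "?this \<longleftrightarrow> ((\<lambda>p. f (fst p) * g (snd p)) has_sum (A * B)) ({0<..} \<times> {0<..})"
    using f(3) g(3) by (intro has_sum_cong_neutral) (auto intro!: Nat.gr0I)
  also have "\<dots> \<longleftrightarrow> ((\<lambda>p. f (snd p) * g (fst p div snd p)) has_sum (A * B)) (SIGMA n:{0<..}. {d. d dvd n})"
    by (rule has_sum_reindex_bij_witness[where i = "\<lambda>p. (snd p, fst p div snd p)" and j = "\<lambda>p. (fst p * snd p, fst p)"])
      (auto elim!: dvdE)
  finally have "((\<lambda>n. \<Sum>d | d dvd n. f d * g (n div d)) has_sum (A * B)) {0<..}"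
    by (rule has_sum_SigmaD) (auto intro!: has_sum_finite)
  also have "?this \<longleftrightarrow> ((\<lambda>n. \<Sum>d | d dvd n. f d * g (n div d)) has_sum (A * B)) UNIV"
    by (intro has_sum_cong_neutral) auto
  finally show ?thesis by (rule has_sum_imp_sums)
qed

text \<open>
  This is \<open>(z - 1) \<zeta>(z)\<close>: with \<open>w = z - 1\<close>, the telescoping parts of the terms cancel and \<open>w \<zeta>(1 + w)\<close>
  remains. Working with this function avoids the pole.
\<close>

definition zeta_reg :: "complex \<Rightarrow> complex" where
  "zeta_reg z = - (\<Sum>n. power_remainder n (z - 1))"

lemma power_remainder_sums: "Re z > -1 \<Longrightarrow> (\<lambda>n. power_remainder n z) sums (\<Sum>n. power_remainder n z)"
  and holomorphic_zeta_reg: "zeta_reg holomorphic_on {z. Re z > 0}"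
proof -
  obtain g where g: "g holomorphic_on {z. Re z > -1}" "\<And>z. Re z > -1 \<Longrightarrow> (\<lambda>n. power_remainder n z) sums g z"
    using power_remainder_series[of "\<lambda>_. 1" 1 0] by auto
  show "Re z > -1 \<Longrightarrow> (\<lambda>n. power_remainder n z) sums (\<Sum>n. power_remainder n z)"
    using g(2)[of z] by (simp add: sums_iff)
  have "(\<lambda>z. - (g \<circ> (\<lambda>z. z - 1)) z) holomorphic_on {z. Re z > 0}"
    by (intro holomorphic_intros holomorphic_on_compose_gen[OF _ g(1)]) auto
  then show "zeta_reg holomorphic_on {z. Re z > 0}"
    by (rule holomorphic_transform) (use g(2) in \<open>auto simp: zeta_reg_def sums_iff\<close>)
qed

text \<open>
  The residue of \<open>\<zeta>\<close> at 1. Only the term of index 0 survives, because \<open>0 powr 0 = 0\<close> whereas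
  \<open>n powr 0 = 1\<close> for positive \<open>n\<close>.
\<close>

lemma zeta_reg_1: "zeta_reg 1 = 1"
proof -
  have "power_remainder n 0 = (if n = 0 then -1 else 0)" for n
    by (auto simp: power_remainder_def simp del: of_nat_Suc)
  then have "(\<lambda>n. power_remainder n 0) sums (-1)"
    using sums_single[of 0 "\<lambda>_. -1 :: complex"] by (simp add: eq_commute)
  then show ?thesis by (simp add: zeta_reg_def sums_iff)
qed

lemma of_nat_powr_tendsto_0:
  assumes "Re z > 0"
  shows "(\<lambda>n. of_nat n powr (-z) :: complex) \<longlonglongrightarrow> 0"
proof (rule tendsto_norm_zero_cancel)
  show "(\<lambda>n. norm (of_nat n powr (-z) :: complex)) \<longlonglongrightarrow> 0"
    unfolding norm_of_nat_powr using assms by real_asymp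
qed

text \<open>
  The terms of index 0 vanish since \<open>0 powr (-z) = 0\<close>, so sums over all natural numbers are sums
  over the positive ones.
\<close>

lemma zeta_sums:
  assumes z: "Re z > 1"
  shows "(\<lambda>n. of_nat n powr (-z)) sums (zeta_reg z / (z - 1))"
proof -
  define w where "w = z - 1"
  have w: "Re w > 0" "w \<noteq> 0" using z by (auto simp: w_def)
  have "(\<lambda>n. of_nat n powr (-w) - of_nat (Suc n) powr (-w)) sums (of_nat 0 powr (-w) - 0 :: complex)"
    by (rule telescope_sums') (rule of_nat_powr_tendsto_0[OF w(1)])
  from sums_diff[OF this power_remainder_sums[of w]] w
  have "(\<lambda>n. w * of_nat n powr (-1 - w)) sums zeta_reg z"
    by (simp add: power_remainder_def zeta_reg_def w_def)
  then have "(\<lambda>n. w * of_nat n powr (-1 - w) / w) sums (zeta_reg z / w)"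
    by (rule sums_divide)
  moreover have "-1 - w = -z" by (simp add: w_def)
  ultimately show ?thesis using w(2) by (simp add: w_def)
qed

lemma summable_ln_powr:
  fixes x :: real
  assumes "x > 1"
  shows "summable (\<lambda>n. ln (real n) * real n powr (-x))"
proof -
  obtain d where x: "x = 1 + 2 * d" and d: "d > 0"
    using assms by (intro that[of "(x - 1) / 2"]) (auto simp: field_simps)
  have "summable (\<lambda>n. real (n + Suc 1) powr (-1 - d))" by (rule powr_tail_bound[OF d]) simp
  then have s: "summable (\<lambda>n. real n powr (-1 - d))" by (rule summable_iff_shift[THEN iffD1])
  have "\<forall>\<^sub>F n::nat in sequentially. ln (real n) \<le> real n powr d"
    using d by real_asymp
  then have "\<forall>\<^sub>F n in sequentially. norm (ln (real n) * real n powr (-x)) \<le> real n powr (-1 - d)"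
    using eventually_gt_at_top[of 0]
  proof eventually_elim
    case (elim n)
    have "norm (ln (real n) * real n powr (-x)) = ln (real n) * real n powr (-x)"
      using elim by (simp add: abs_mult)
    also have "\<dots> \<le> real n powr d * real n powr (-x)"
      using elim by (intro mult_right_mono) auto
    also have "\<dots> = real n powr (-1 - d)"
      unfolding powr_add[symmetric] by (rule arg_cong2[of _ _ _ _ "(powr)"]) (auto simp: x)
    finally show ?case .
  qed
  then show ?thesis by (rule summable_comparison_test_ev) (rule s)
qed

lemma summable_powr_minus:
  fixes x :: real
  assumes "x > 1"
  shows "summable (\<lambda>n. real n powr (-x))"
proof -
  have "summable (\<lambda>n. real (n + Suc 1) powr (-1 - (x - 1)))" using assms by (intro powr_tail_bound) auto
  then have "summable (\<lambda>n. real n powr (-1 - (x - 1)))" by (rule summable_iff_shift[THEN iffD1])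
  then show ?thesis by simp
qed

section \<open>The logarithmic derivative and zeros on the line\<close>

text \<open>
  The Dirichlet series of \<open>- \<zeta>' / \<zeta>\<close>.
\<close>

definition mangoldt_series :: "complex \<Rightarrow> complex" where
  "mangoldt_series z = (\<Sum>n. mangoldt n * of_nat n powr (-z))"

lemma summable_mangoldt_powr:
  fixes x :: real
  assumes "x > 1"
  shows "summable (\<lambda>n. mangoldt n * real n powr (-x))"
proof (rule summable_comparison_test'[OF summable_ln_powr[OF assms], of 0])
  fix n :: nat
  show "norm (mangoldt n * real n powr (-x)) \<le> ln (real n) * real n powr (-x)"
    using mangoldt_le[of n] by (cases "n = 0") (auto simp: abs_mult mult_right_mono)
qed

lemma mangoldt_series_sums:
  assumes z: "Re z > 1"
  shows "summable (\<lambda>n. norm (mangoldt n * of_nat n powr (-z) :: complex))"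
    and "(\<lambda>n. mangoldt n * of_nat n powr (-z)) sums mangoldt_series z"
proof -
  show 1: "summable (\<lambda>n. norm (mangoldt n * of_nat n powr (-z) :: complex))"
    using summable_mangoldt_powr[OF z] by (simp add: norm_mult)
  show "(\<lambda>n. mangoldt n * of_nat n powr (-z)) sums mangoldt_series z"
    unfolding mangoldt_series_def by (rule summable_sums[OF summable_norm_cancel[OF 1]])
qed

text \<open>
  The identity \<open>\<Sum>\<^bsub>d dvd n\<^esub> \<Lambda>(d) = ln n\<close> in terms of Dirichlet series. It replaces the Euler product.
\<close>

lemma ln_series_sums_product:
  assumes z: "Re z > 1"
  shows "(\<lambda>n. of_real (ln (real n)) * of_nat n powr (-z)) sums (mangoldt_series z * (zeta_reg z / (z - 1)))"
proof -
  have "(\<lambda>n. \<Sum>d | d dvd n. (mangoldt d * of_nat d powr (-z)) * of_nat (n div d) powr (-z))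
          sums (mangoldt_series z * (zeta_reg z / (z - 1)))"
  proof (rule dirichlet_product_sums)
    show "summable (\<lambda>n. norm (of_nat n powr (-z) :: complex))"
      using summable_powr_minus[OF z] by simp
  qed (use mangoldt_series_sums[OF z] zeta_sums[OF z] in auto)
  moreover have "(\<Sum>d | d dvd n. (mangoldt d * of_nat d powr (-z)) * of_nat (n div d) powr (-z))
      = of_real (ln (real n)) * (of_nat n powr (-z) :: complex)" for n
  proof (cases "n = 0")
    case False
    have "(mangoldt d * of_nat d powr (-z)) * of_nat (n div d) powr (-z) = mangoldt d * (of_nat n powr (-z) :: complex)"
      if d: "d dvd n" for d
    proof -
      obtain m where m: "n = d * m" using d by blast
      have "ln (real n) = ln (real d) + ln (real m)" using m False by (simp add: ln_mult)
      then show ?thesis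
        using m False by (simp add: of_nat_powr_complex algebra_simps flip: exp_add of_nat_mult)
    qed
    then have "(\<Sum>d | d dvd n. (mangoldt d * of_nat d powr (-z)) * of_nat (n div d) powr (-z))
        = (\<Sum>d | d dvd n. mangoldt d * (of_nat n powr (-z) :: complex))"
      by (intro sum.cong) auto
    also have "\<dots> = (\<Sum>d | d dvd n. mangoldt d) * of_nat n powr (-z)"
      by (rule sum_distrib_right[symmetric])
    finally show ?thesis using mangoldt_sum[of n, where 'a = complex] False by simp
  qed auto
  ultimately show ?thesis by simp
qed


text \<open>
  The same series is \<open>- \<zeta>'\<close>, by termwise differentiation of the series of \<open>\<zeta> = zeta_reg / (z - 1)\<close>.
\<close>

lemma ln_series_sums_derivative:
  assumes z: "Re z > 1"
  shows "(\<lambda>n. of_real (ln (real n)) * of_nat n powr (-z)) sums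
           (zeta_reg z / (z - 1)\<^sup>2 - deriv zeta_reg z / (z - 1))"
proof -
  let ?H = "{z. Re z > 1}"
  have op: "open ?H" by (rule open_halfspace_Re_gt)
  have "\<exists>g g'. \<forall>x\<in>?H. (\<lambda>n. of_nat n powr (-x)) sums g x
      \<and> (\<lambda>n. - (of_real (ln (real n)) * of_nat n powr (-x))) sums g' x \<and> (g has_field_derivative g' x) (at x)"
  proof (rule series_and_derivative_comparison_local[OF op])
    fix n and x :: complex
    show "((\<lambda>x. of_nat n powr (-x)) has_field_derivative - (of_real (ln (real n)) * of_nat n powr (-x))) (at x)"
      by (cases "n = 0") (auto simp: of_nat_powr_complex intro!: derivative_eq_intros)
  next
    fix x assume x: "x \<in> ?H"
    define d where "d = (Re x - 1) / 2"
    have d: "d > 0" "Re x = 1 + 2 * d" using x by (simp_all add: d_def field_simps)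
    have "norm (of_nat n powr (-y) :: complex) \<le> real n powr (-(1 + d))" if "y \<in> ball x d" for n y
    proof -
      have "Re x - Re y \<le> norm (x - y)" using complex_Re_le_cmod[of "x - y"] by simp
      then have "Re y \<ge> 1 + d" using that d by (simp add: dist_norm)
      then show ?thesis unfolding norm_of_nat_powr
        by (cases "n = 0") (auto intro!: powr_mono)
    qed
    moreover have "summable (\<lambda>n. real n powr (-(1 + d)))" using d by (intro summable_powr_minus) auto
    ultimately show "\<exists>d h. 0 < d \<and> summable h \<and>
        (\<forall>\<^sub>F n in sequentially. \<forall>y\<in>ball x d \<inter> ?H. norm (of_nat n powr (-y) :: complex) \<le> h n)"
      using d(1) by (intro exI[of _ d] exI[of _ "\<lambda>n. real n powr (-(1 + d))"]) auto
  qed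
  then obtain g g' where g: "\<And>x. x \<in> ?H \<Longrightarrow> (\<lambda>n. of_nat n powr (-x)) sums g x"
    "\<And>x. x \<in> ?H \<Longrightarrow> (\<lambda>n. - (of_real (ln (real n)) * of_nat n powr (-x))) sums g' x"
    "\<And>x. x \<in> ?H \<Longrightarrow> (g has_field_derivative g' x) (at x)" by blast
  have "g x = zeta_reg x / (x - 1)" if "x \<in> ?H" for x
    using g(1)[OF that] zeta_sums[of x] that by (auto intro: sums_unique2)
  then have "((\<lambda>x. zeta_reg x / (x - 1)) has_field_derivative g' z) (at z)"
    using z by (intro has_field_derivative_transform_within_open[OF g(3) op]) auto
  moreover have "(zeta_reg has_field_derivative deriv zeta_reg z) (at z)"
    using z by (intro holomorphic_derivI[OF holomorphic_zeta_reg open_halfspace_Re_gt]) auto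
  then have "((\<lambda>x. zeta_reg x / (x - 1)) has_field_derivative
      (deriv zeta_reg z * (z - 1) - zeta_reg z) / ((z - 1) * (z - 1))) (at z)"
    using z by (auto intro!: derivative_eq_intros)
  ultimately have "g' z = (deriv zeta_reg z * (z - 1) - zeta_reg z) / ((z - 1) * (z - 1))"
    by (rule DERIV_unique)
  also have "\<dots> = - (zeta_reg z / (z - 1)\<^sup>2 - deriv zeta_reg z / (z - 1))"
  proof -
    have "z - 1 \<noteq> 0" using z by auto
    then show ?thesis by (simp add: diff_divide_distrib power2_eq_square)
  qed
  finally have "g' z = \<dots>" .
  then show ?thesis using sums_minus[OF g(2)[of z]] z by simp
qed

text \<open>
  The logarithmic derivative of \<open>\<zeta>\<close>, cleared of denominators that are not yet known to be
  nonzero.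
\<close>

lemma mangoldt_series_mult_zeta_reg:
  assumes z: "Re z > 1"
  shows "mangoldt_series z * zeta_reg z = zeta_reg z / (z - 1) - deriv zeta_reg z"
proof -
  have nz: "z - 1 \<noteq> 0" using z by auto
  have "mangoldt_series z * (zeta_reg z / (z - 1)) = zeta_reg z / (z - 1)\<^sup>2 - deriv zeta_reg z / (z - 1)"
    using ln_series_sums_product[OF z] ln_series_sums_derivative[OF z] by (rule sums_unique2)
  then have "mangoldt_series z * (zeta_reg z / (z - 1)) * (z - 1)
      = (zeta_reg z / (z - 1)\<^sup>2 - deriv zeta_reg z / (z - 1)) * (z - 1)" by simp
  moreover have "zeta_reg z / (z - 1)\<^sup>2 * (z - 1) = zeta_reg z / (z - 1)"
    by (simp add: power2_eq_square)
  ultimately show ?thesis using nz by (simp add: left_diff_distrib[of _ "deriv zeta_reg z / (z - 1)"])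
qed

text \<open>
  Zeros have finite order because the function is not identically zero; a point that is not a
  zero has order \<open>m = 0\<close>.
\<close>

lemma zeta_reg_factor:
  assumes z0: "Re z0 > 0"
  obtains r g and m :: nat where "r > 0" "g holomorphic_on ball z0 r" "ball z0 r \<subseteq> {z. Re z > 0}"
    "\<And>w. w \<in> ball z0 r \<Longrightarrow> zeta_reg w = (w - z0) ^ m * g w"
    "\<And>w. w \<in> ball z0 r \<Longrightarrow> g w \<noteq> 0"
proof -
  let ?H = "{z. Re z > 0}"
  have op: "open ?H" by (rule open_halfspace_Re_gt)
  have con: "connected ?H" by (intro convex_connected convex_halfspace_Re_gt)
  show ?thesis
  proof (cases "zeta_reg z0 = 0")
    case True
    then have "\<not> zeta_reg constant_on ?H"
      using zeta_reg_1 z0 unfolding constant_on_def by force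
    then show ?thesis
      using holomorphic_factor_zero_nonconstant[OF holomorphic_zeta_reg op con _ True] z0 that
      by (metis mem_Collect_eq)
  next
    case False
    have "continuous_on ?H zeta_reg"
      by (intro holomorphic_on_imp_continuous_on holomorphic_zeta_reg)
    then have "open (?H \<inter> zeta_reg -` (- {0}))"
      by (intro continuous_open_preimage op) auto
    moreover have "z0 \<in> ?H \<inter> zeta_reg -` (- {0})" using False z0 by auto
    ultimately obtain r where r: "r > 0" "ball z0 r \<subseteq> ?H \<inter> zeta_reg -` (- {0})"
      by (meson open_contains_ball)
    show ?thesis
      by (rule that[of r zeta_reg 0]) (use r in \<open>auto intro!: holomorphic_on_subset[OF holomorphic_zeta_reg]\<close>)
  qed
qed

text \<open>
  Near \<open>z0\<close> the series is \<open>1/(z - 1)\<close> minus the logarithmic derivative of \<open>zeta_reg\<close>, so the limit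
  reads off the pole at 1 and the order of the zero at \<open>z0\<close>.
\<close>

lemma mangoldt_series_boundary_limit:
  assumes z0: "Re z0 \<ge> 1"
  obtains m :: nat where "zeta_reg z0 = 0 \<longleftrightarrow> m > 0"
    "((\<lambda>\<sigma>. of_real \<sigma> * mangoldt_series (z0 + of_real \<sigma>)) \<longlongrightarrow> (if z0 = 1 then 1 else 0) - of_nat m) (at_right 0)"
proof -
  have "Re z0 > 0" using z0 by simp
  then obtain r g and m :: nat where r: "r > 0" "g holomorphic_on ball z0 r" "ball z0 r \<subseteq> {z. Re z > 0}"
    and zg: "\<And>w. w \<in> ball z0 r \<Longrightarrow> zeta_reg w = (w - z0) ^ m * g w"
    and gnz: "\<And>w. w \<in> ball z0 r \<Longrightarrow> g w \<noteq> 0"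
    by (rule zeta_reg_factor) (rule that; simp)
  have cont: "((\<lambda>\<sigma>. z0 + of_real \<sigma>) \<longlongrightarrow> z0) (at_right 0)"
    using tendsto_add[OF tendsto_const[of z0] tendsto_of_real[OF tendsto_ident_at[of 0 "{0<..}"]]] by simp
  have z0b: "z0 \<in> ball z0 r" using r by simp
  have "isCont g z0" "isCont (deriv g) z0"
    using holomorphic_on_imp_differentiable_at[OF r(2) open_ball z0b]
      holomorphic_on_imp_differentiable_at[OF holomorphic_deriv[OF r(2) open_ball] open_ball z0b]
    by (simp_all add: field_differentiable_imp_continuous_at)
  then have "((\<lambda>\<sigma>. deriv g (z0 + of_real \<sigma>) / g (z0 + of_real \<sigma>)) \<longlongrightarrow> deriv g z0 / g z0) (at_right 0)"
    using gnz[OF z0b] by (intro tendsto_divide isCont_tendsto_compose[OF _ cont])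
  then have A: "((\<lambda>\<sigma>. of_nat m + of_real \<sigma> * (deriv g (z0 + of_real \<sigma>) / g (z0 + of_real \<sigma>))) \<longlongrightarrow> of_nat m + of_real 0 * (deriv g z0 / g z0)) (at_right 0)"
    by (intro tendsto_add tendsto_mult tendsto_const tendsto_of_real tendsto_ident_at)
  have B: "((\<lambda>\<sigma>. of_real \<sigma> / (z0 + of_real \<sigma> - 1)) \<longlongrightarrow> (if z0 = 1 then 1 else 0)) (at_right 0)"
  proof (cases "z0 = 1")
    case True
    have "\<forall>\<^sub>F \<sigma> in at_right (0::real). of_real \<sigma> / (z0 + of_real \<sigma> - 1) = 1"
      using eventually_at_right_less[of "0::real"] by eventually_elim (simp add: True)
    then show ?thesis using True by (simp add: tendsto_eventually)
  next
    case False
    have "((\<lambda>\<sigma>. of_real \<sigma> :: complex) \<longlongrightarrow> of_real 0) (at_right (0::real))"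
      by (rule tendsto_of_real[OF tendsto_ident_at])
    moreover have "((\<lambda>\<sigma>. z0 + of_real \<sigma> - 1) \<longlongrightarrow> z0 - 1) (at_right (0::real))"
      by (rule tendsto_diff[OF cont tendsto_const])
    ultimately have "((\<lambda>\<sigma>. of_real \<sigma> / (z0 + of_real \<sigma> - 1)) \<longlongrightarrow> of_real 0 / (z0 - 1)) (at_right (0::real))"
      by (rule tendsto_divide) (use False in simp)
    then show ?thesis using False by simp
  qed
  have lim: "((\<lambda>\<sigma>. of_real \<sigma> / (z0 + of_real \<sigma> - 1) -
      (of_nat m + of_real \<sigma> * (deriv g (z0 + of_real \<sigma>) / g (z0 + of_real \<sigma>)))) \<longlongrightarrow> (if z0 = 1 then 1 else 0) - of_nat m) (at_right 0)"
    using tendsto_diff[OF B A] by simp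
  have "\<forall>\<^sub>F \<sigma> in at_right (0::real). \<sigma> < r"
    using eventually_at_right_real[OF r(1)] by (auto elim: eventually_mono)
  then have "\<forall>\<^sub>F \<sigma> in at_right (0::real). of_real \<sigma> / (z0 + of_real \<sigma> - 1) -
      (of_nat m + of_real \<sigma> * (deriv g (z0 + of_real \<sigma>) / g (z0 + of_real \<sigma>))) = of_real \<sigma> * mangoldt_series (z0 + of_real \<sigma>)"
    using eventually_at_right_less[of "0::real"]
  proof eventually_elim
    case (elim \<sigma>)
    define w where "w = z0 + of_real \<sigma>"
    have wb: "w \<in> ball z0 r" using elim by (simp add: w_def dist_norm)
    have wz: "w - z0 = of_real \<sigma>" by (simp add: w_def)
    have w1: "Re w > 1" using z0 elim by (simp add: w_def)
    have nz: "zeta_reg w \<noteq> 0" using zg[OF wb] gnz[OF wb] elim wz by simp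
    have "(g has_field_derivative deriv g w) (at w)"
      using r wb by (intro holomorphic_derivI[OF r(2)]) auto
    then have "((\<lambda>w. (w - z0) ^ m * g w) has_field_derivative
        (of_nat m * (w - z0) ^ (m - 1) * g w + (w - z0) ^ m * deriv g w)) (at w)"
      by (auto intro!: derivative_eq_intros)
    then have "(zeta_reg has_field_derivative
        (of_nat m * (w - z0) ^ (m - 1) * g w + (w - z0) ^ m * deriv g w)) (at w)"
      by (rule has_field_derivative_transform_within_open[OF _ open_ball wb]) (simp add: zg)
    then have d: "deriv zeta_reg w = of_nat m * (w - z0) ^ (m - 1) * g w + (w - z0) ^ m * deriv g w"
      by (rule DERIV_imp_deriv)
    have "(w - z0) * deriv zeta_reg w = (of_nat m + (w - z0) * (deriv g w / g w)) * zeta_reg w"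
      unfolding d zg[OF wb] using gnz[OF wb] by (cases m) (auto simp: field_simps)
    moreover have "mangoldt_series w = 1 / (w - 1) - deriv zeta_reg w / zeta_reg w"
      using mangoldt_series_mult_zeta_reg[OF w1] nz by (simp add: field_simps)
    ultimately have "(w - z0) * mangoldt_series w = (w - z0) / (w - 1) - (of_nat m + (w - z0) * (deriv g w / g w))"
      using nz by (simp add: right_diff_distrib)
    then show ?case by (simp add: wz flip: w_def)
  qed
  then have "((\<lambda>\<sigma>. of_real \<sigma> * mangoldt_series (z0 + of_real \<sigma>)) \<longlongrightarrow> (if z0 = 1 then 1 else 0) - of_nat m) (at_right 0)"
    using lim by (simp add: tendsto_cong)
  moreover have "zeta_reg z0 = 0 \<longleftrightarrow> m > 0"
    using zg[OF z0b] gnz[OF z0b] by auto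
  ultimately show ?thesis using that by blast
qed

text \<open>
  Each term has the factor \<open>3 + 4 cos \<theta> + cos (2\<theta>) = 2 (1 + cos \<theta>)\<^sup>2\<close> with \<open>\<theta> = t ln n\<close>.
\<close>

lemma Re_mangoldt_series_3_4_1:
  assumes "x > 1"
  shows "Re (3 * mangoldt_series (of_real x) + 4 * mangoldt_series (Complex x t) + mangoldt_series (Complex x (2 * t))) \<ge> 0"
proof -
  have "(\<lambda>n. 3 * (mangoldt n * of_nat n powr (- of_real x)) + 4 * (mangoldt n * of_nat n powr (- Complex x t))
      + mangoldt n * of_nat n powr (- Complex x (2 * t))) sums
      (3 * mangoldt_series (of_real x) + 4 * mangoldt_series (Complex x t) + mangoldt_series (Complex x (2 * t)))"
    by (rule sums_add[OF sums_add[OF sums_mult sums_mult]]; rule mangoldt_series_sums(2)) (use assms in auto)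
  then have s: "(\<lambda>n. Re (3 * (mangoldt n * of_nat n powr (- of_real x)) + 4 * (mangoldt n * of_nat n powr (- Complex x t))
      + mangoldt n * of_nat n powr (- Complex x (2 * t)))) sums
      Re (3 * mangoldt_series (of_real x) + 4 * mangoldt_series (Complex x t) + mangoldt_series (Complex x (2 * t)))"
    by (rule sums_Re)
  have "Re (3 * (mangoldt n * of_nat n powr (- of_real x)) + 4 * (mangoldt n * of_nat n powr (- Complex x t))
      + mangoldt n * of_nat n powr (- Complex x (2 * t))) \<ge> 0" for n
  proof (cases "n = 0")
    case False
    define \<theta> where "\<theta> = t * ln (real n)"
    have R: "Re (of_nat n powr (- Complex x y)) = exp (- x * ln (real n)) * cos (y * ln (real n))" for y
      using False by (simp add: of_nat_powr_complex Re_exp)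
    have "of_real x = Complex x 0" by (simp add: complex_eq_iff)
    then have "Re (3 * (mangoldt n * of_nat n powr (- of_real x)) + 4 * (mangoldt n * of_nat n powr (- Complex x t))
      + mangoldt n * of_nat n powr (- Complex x (2 * t)))
      = mangoldt n * exp (- x * ln (real n)) * (3 + 4 * cos \<theta> + cos (2 * \<theta>))"
      by (simp add: R \<theta>_def algebra_simps)
    also have "3 + 4 * cos \<theta> + cos (2 * \<theta>) = 2 * (1 + cos \<theta>)\<^sup>2"
      unfolding cos_double_cos by (simp add: power2_eq_square algebra_simps)
    finally show ?thesis by (simp add: mangoldt_nonneg)
  qed auto
  then show ?thesis using s by (rule sums_le[OF _ sums_zero])
qed

text \<open>
  On the line \<open>Re z = 1\<close>, multiplying the 3-4-1 inequality by \<open>\<sigma>\<close> and letting \<open>\<sigma>\<close> tend to 0 gives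
  \<open>3 - 4 m1 - m2 \<ge> 0\<close> for the orders \<open>m1\<close>, \<open>m2\<close> of the zeros at \<open>1 + \<i>t\<close> and \<open>1 + 2\<i>t\<close>, hence
  \<open>m1 = 0\<close>. To the right of the line the series is bounded near \<open>z0\<close>, so the limit is 0 and the
  order is 0.
\<close>

lemma zeta_reg_nonzero:
  assumes "Re z0 \<ge> 1"
  shows "zeta_reg z0 \<noteq> 0"
proof (cases "Re z0 = 1")
  case True
  define t where "t = Im z0"
  have z0: "z0 = Complex 1 t" using True by (simp add: t_def complex_eq_iff)
  show ?thesis
  proof (cases "t = 0")
    case True
    then have "z0 = 1" using z0 by (simp add: complex_eq_iff)
    then show ?thesis by (simp add: zeta_reg_1)
  next
    case False
    obtain m0 where m0: "zeta_reg 1 = 0 \<longleftrightarrow> m0 > 0"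
      "((\<lambda>\<sigma>. of_real \<sigma> * mangoldt_series (1 + of_real \<sigma>)) \<longlongrightarrow> 1 - of_nat m0) (at_right 0)"
      using mangoldt_series_boundary_limit[of 1] by auto
    obtain m1 where m1: "zeta_reg z0 = 0 \<longleftrightarrow> m1 > 0"
      "((\<lambda>\<sigma>. of_real \<sigma> * mangoldt_series (z0 + of_real \<sigma>)) \<longlongrightarrow> - of_nat m1) (at_right 0)"
      using mangoldt_series_boundary_limit[of z0] False z0 by (auto simp: complex_eq_iff)
    obtain m2 where m2:
      "((\<lambda>\<sigma>. of_real \<sigma> * mangoldt_series (Complex 1 (2 * t) + of_real \<sigma>)) \<longlongrightarrow> - of_nat m2) (at_right 0)"
      using mangoldt_series_boundary_limit[of "Complex 1 (2 * t)"] False by (auto simp: complex_eq_iff)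
    have "m0 = 0" using m0(1) zeta_reg_1 by simp
    have "((\<lambda>\<sigma>. Re (3 * (of_real \<sigma> * mangoldt_series (1 + of_real \<sigma>)) + 4 * (of_real \<sigma> * mangoldt_series (z0 + of_real \<sigma>))
       + of_real \<sigma> * mangoldt_series (Complex 1 (2 * t) + of_real \<sigma>))) \<longlongrightarrow>
       Re (3 * (1 - of_nat m0) + 4 * (- of_nat m1) + (- of_nat m2))) (at_right (0::real))"
      by (intro tendsto_intros m0 m1 m2)
    moreover have "\<forall>\<^sub>F \<sigma> in at_right (0::real). Re (3 * (of_real \<sigma> * mangoldt_series (1 + of_real \<sigma>)) + 4 * (of_real \<sigma> * mangoldt_series (z0 + of_real \<sigma>))
       + of_real \<sigma> * mangoldt_series (Complex 1 (2 * t) + of_real \<sigma>)) \<ge> 0"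
      using eventually_at_right_less[of "0::real"]
    proof eventually_elim
      case (elim \<sigma>)
      have e: "1 + of_real \<sigma> = (of_real (1 + \<sigma>) :: complex)" "z0 + of_real \<sigma> = Complex (1 + \<sigma>) t"
        "Complex 1 (2 * t) + of_real \<sigma> = Complex (1 + \<sigma>) (2 * t)" by (simp_all add: z0 complex_eq_iff)
      have "Re (3 * (of_real \<sigma> * mangoldt_series (1 + of_real \<sigma>)) + 4 * (of_real \<sigma> * mangoldt_series (z0 + of_real \<sigma>))
       + of_real \<sigma> * mangoldt_series (Complex 1 (2 * t) + of_real \<sigma>))
        = \<sigma> * Re (3 * mangoldt_series (of_real (1 + \<sigma>)) + 4 * mangoldt_series (Complex (1 + \<sigma>) t) + mangoldt_series (Complex (1 + \<sigma>) (2 * t)))"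
        unfolding e by (simp add: algebra_simps)
      also have "\<dots> \<ge> 0" using Re_mangoldt_series_3_4_1[of "1 + \<sigma>" t] elim by simp
      finally show ?case .
    qed
    ultimately have "0 \<le> Re (3 * (1 - of_nat m0) + 4 * (- of_nat m1) + (- of_nat m2))"
      by (rule tendsto_lowerbound) simp
    then have "4 * real m1 + real m2 \<le> 3" using \<open>m0 = 0\<close> by simp
    then have "m1 = 0" by linarith
    then show ?thesis using m1(1) by simp
  qed
next
  case False
  then have z0: "Re z0 > 1" using assms by simp
  obtain m where m0: "zeta_reg z0 = 0 \<longleftrightarrow> m > 0"
    "((\<lambda>\<sigma>. of_real \<sigma> * mangoldt_series (z0 + of_real \<sigma>)) \<longlongrightarrow> (if z0 = 1 then 1 else 0) - of_nat m) (at_right 0)"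
    by (rule mangoldt_series_boundary_limit[OF assms])
  have "z0 \<noteq> 1" using z0 by auto
  with m0 have m: "zeta_reg z0 = 0 \<longleftrightarrow> m > 0"
    "((\<lambda>\<sigma>. of_real \<sigma> * mangoldt_series (z0 + of_real \<sigma>)) \<longlongrightarrow> - of_nat m) (at_right 0)" by simp_all
  define B where "B = (\<Sum>n. mangoldt n * real n powr (- Re z0))"
  have "norm (mangoldt_series (z0 + of_real \<sigma>)) \<le> B" if "\<sigma> > 0" for \<sigma>
    unfolding mangoldt_series_def B_def
  proof (rule norm_suminf_le)
    fix n
    show "norm (mangoldt n * of_nat n powr (- (z0 + of_real \<sigma>)) :: complex) \<le> mangoldt n * real n powr (- Re z0)"
      using that unfolding norm_mult norm_of_nat_powr
      by (cases "n = 0") (auto intro!: mult_left_mono powr_mono mangoldt_nonneg)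
  qed (rule summable_mangoldt_powr[OF z0])
  then have "\<forall>\<^sub>F \<sigma> in at_right (0::real). norm (of_real \<sigma> * mangoldt_series (z0 + of_real \<sigma>)) \<le> \<sigma> * B"
    using eventually_at_right_less[of "0::real"]
    by (auto elim!: eventually_mono simp: norm_mult intro!: mult_left_mono)
  moreover have "((\<lambda>\<sigma>. \<sigma> * B) \<longlongrightarrow> 0) (at_right (0::real))"
    by (auto intro!: tendsto_eq_intros)
  ultimately have "((\<lambda>\<sigma>. of_real \<sigma> * mangoldt_series (z0 + of_real \<sigma>)) \<longlongrightarrow> 0) (at_right 0)"
    by (rule Lim_null_comparison)
  then have "- of_nat m = (0 :: complex)" using m(2) by (intro tendsto_unique[of "at_right (0::real)"]) auto
  then show ?thesis using m(1) by simp
qed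


section \<open>Primes in short intervals\<close>

text \<open>
  Partial summation; the boundary term \<open>\<psi>(M) (M + 1) powr (-z)\<close> tends to 0 by Chebyshev's bound.
\<close>

lemma psi_partial_summation_sums:
  assumes z: "Re z > 1"
  shows "(\<lambda>n. of_real (chebyshev_psi n) * (of_nat n powr (-z) - of_nat (Suc n) powr (-z))) sums mangoldt_series z"
proof -
  have part: "(\<Sum>n\<le>M. of_real (chebyshev_psi n) * (of_nat n powr (-z) - of_nat (Suc n) powr (-z)))
     = (\<Sum>n\<le>M. mangoldt n * of_nat n powr (-z)) - of_real (chebyshev_psi M) * of_nat (Suc M) powr (-z)" for M
  proof (induction M)
    case 0
    then show ?case by (simp add: chebyshev_psi_def)
  next
    case (Suc M)
    then show ?case by (simp add: chebyshev_psi_Suc algebra_simps del: of_nat_Suc)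
  qed
  have "(\<lambda>M. of_real (chebyshev_psi M) * of_nat (Suc M) powr (-z) :: complex) \<longlonglongrightarrow> 0"
  proof (rule Lim_null_comparison)
    show "\<forall>\<^sub>F M in sequentially. norm (of_real (chebyshev_psi M) * of_nat (Suc M) powr (-z) :: complex)
        \<le> 4 * real M * real (Suc M) powr (- Re z)"
    proof (intro always_eventually allI)
      fix M
      show "norm (of_real (chebyshev_psi M) * of_nat (Suc M) powr (-z) :: complex) \<le> 4 * real M * real (Suc M) powr (- Re z)"
        unfolding norm_mult norm_of_nat_powr
        using chebyshev_psi_le[of M] chebyshev_psi_nonneg[of M] by (auto intro!: mult_right_mono)
    qed
    show "(\<lambda>M. 4 * real M * real (Suc M) powr (- Re z)) \<longlonglongrightarrow> 0"
      using z by real_asymp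
  qed
  moreover have "(\<lambda>M. \<Sum>n\<le>M. mangoldt n * of_nat n powr (-z)) \<longlonglongrightarrow> mangoldt_series z"
    using mangoldt_series_sums(2)[OF z] by (simp add: sums_def_le)
  ultimately have "(\<lambda>M. (\<Sum>n\<le>M. mangoldt n * of_nat n powr (-z)) - of_real (chebyshev_psi M) * of_nat (Suc M) powr (-z))
      \<longlonglongrightarrow> mangoldt_series z - 0"
    by (intro tendsto_diff)
  then show ?thesis unfolding sums_def_le part by simp
qed

text \<open>
  Replacing the telescoping differences in the partial summation by \<open>z n powr (-1 - z)\<close> changes the
  series by the power remainder series \<open>V\<close> of \<open>\<psi>\<close>, which is holomorphic for \<open>Re z > 0\<close>. So the
  Dirichlet series of \<open>\<psi>(n)/n - 1\<close> is \<open>(- \<zeta>'/\<zeta> - V)/z - \<zeta>\<close>. The poles at 1 of the two terms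
  cancel, and nothing else obstructs continuation to a neighbourhood of \<open>Re z \<ge> 1\<close>.
\<close>

theorem psi_error_sum_convergent:
  "convergent (\<lambda>N. \<Sum>n=1..N. (chebyshev_psi n / n - 1) / n)"
proof -
  obtain V where V: "V holomorphic_on {z. Re z > 0}"
    "\<And>z. Re z > 0 \<Longrightarrow> (\<lambda>n. of_real (chebyshev_psi n) * power_remainder n z) sums V z"
  proof (rule power_remainder_series[of "\<lambda>n. of_real (chebyshev_psi n)" 4 1])
    fix n :: nat assume "n > 0"
    then show "norm (of_real (chebyshev_psi n) :: complex) \<le> 4 * real n powr 1"
      using chebyshev_psi_le[of n] chebyshev_psi_nonneg[of n] by simp
  qed auto
  define U where "U = {z. Re z > 0} \<inter> zeta_reg -` (- {0})"
  have "open U" unfolding U_def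
    by (intro continuous_open_preimage holomorphic_on_imp_continuous_on holomorphic_zeta_reg open_halfspace_Re_gt) auto
  have U: "{z. Re z \<ge> 1} \<subseteq> U"
    using zeta_reg_nonzero by (auto simp: U_def)
  have UH: "U \<subseteq> {z. Re z > 0}" by (auto simp: U_def)
  define q where "q z = (if z = 1 then deriv zeta_reg 1 else (zeta_reg z - zeta_reg 1) / (z - 1))" for z
  \<comment> \<open>By \<open>1/(z (z - 1)) = 1/(z - 1) - 1/z\<close>, the polar part is \<open>(1 - zeta_reg z)/(z - 1)\<close>, which
    the difference quotient \<open>q\<close> continues to 1.\<close>
  define F where "F z = - q z - 1 / z - (deriv zeta_reg z / zeta_reg z + V z) / z" for z
  have holZ: "zeta_reg holomorphic_on U" "deriv zeta_reg holomorphic_on U"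
    using holomorphic_zeta_reg holomorphic_deriv[OF holomorphic_zeta_reg open_halfspace_Re_gt] UH
    by (auto intro: holomorphic_on_subset)
  have "q holomorphic_on U"
    unfolding q_def using pole_lemma_open[OF holZ(1) \<open>open U\<close>] .
  then have holF: "F holomorphic_on U"
    unfolding F_def using \<open>open U\<close> holZ holomorphic_on_subset[OF V(1) UH]
    by (intro holomorphic_intros) (auto simp: U_def)
  have sF: "(\<lambda>n. of_real (chebyshev_psi n / n - 1) * of_nat n powr (-z)) sums F z" if z: "Re z > 1" for z
  proof -
    have nz: "z \<noteq> 0" "z \<noteq> 1" "z - 1 \<noteq> 0" "zeta_reg z \<noteq> 0" using z zeta_reg_nonzero[of z] by auto
    have "(\<lambda>n. of_real (chebyshev_psi n) * (of_nat n powr (-z) - of_nat (Suc n) powr (-z))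
        - of_real (chebyshev_psi n) * power_remainder n z) sums (mangoldt_series z - V z)"
      using z by (intro sums_diff psi_partial_summation_sums V) auto
    moreover have "of_real (chebyshev_psi n) * (of_nat n powr (-z) - of_nat (Suc n) powr (-z))
        - of_real (chebyshev_psi n) * power_remainder n z = z * (of_real (chebyshev_psi n) * of_nat n powr (-1 - z))" for n
      by (simp add: power_remainder_def algebra_simps)
    ultimately have "(\<lambda>n. z * (of_real (chebyshev_psi n) * of_nat n powr (-1 - z))) sums (mangoldt_series z - V z)"
      by simp
    then have "(\<lambda>n. of_real (chebyshev_psi n) * of_nat n powr (-1 - z)) sums ((mangoldt_series z - V z) / z)"
      using nz(1) by (drule_tac sums_divide[where c = z]) simp
    then have "(\<lambda>n. of_real (chebyshev_psi n) * of_nat n powr (-1 - z) - of_nat n powr (-z)) sums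
        ((mangoldt_series z - V z) / z - zeta_reg z / (z - 1))"
      by (intro sums_diff zeta_sums z)
    moreover have "of_real (chebyshev_psi n) * of_nat n powr (-1 - z) - of_nat n powr (-z)
       = of_real (chebyshev_psi n / n - 1) * (of_nat n powr (-z) :: complex)" for n
    proof (cases "n = 0")
      case False
      have "of_nat n powr (-1 - z) = of_nat n powr (-z) / (of_nat n :: complex)"
        using False powr_diff[of "of_nat n :: complex" "-z" 1] by (simp add: minus_diff_commute)
      then show ?thesis using False by (simp add: field_simps)
    qed auto
    moreover have "(mangoldt_series z - V z) / z - zeta_reg z / (z - 1) = F z"
    proof -
      have m: "mangoldt_series z = 1 / (z - 1) - deriv zeta_reg z / zeta_reg z"
        using mangoldt_series_mult_zeta_reg[OF z] nz by (simp add: field_simps)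
      have "1 / (z - 1) / z = 1 / (z - 1) - 1 / z"
        using nz by (simp add: divide_simps)
      then show ?thesis
        using nz unfolding F_def q_def m zeta_reg_1
        by (simp add: diff_divide_distrib add_divide_distrib)
    qed
    ultimately show ?thesis by simp
  qed
  have "norm (of_real (chebyshev_psi n / n - 1) :: complex) \<le> 5" for n
  proof (cases "n = 0")
    case False
    then have "chebyshev_psi n / n \<le> 4" using chebyshev_psi_le[of n] by (simp add: field_simps)
    moreover have "chebyshev_psi n / n \<ge> 0" using chebyshev_psi_nonneg by simp
    ultimately show ?thesis unfolding norm_of_real by linarith
  qed auto
  then have "(\<lambda>N. \<Sum>n=1..N. of_real (chebyshev_psi n / n - 1) / of_nat n) \<longlonglongrightarrow> F 1"
    by (rule newman_tauberian[OF _ \<open>open U\<close> U holF sF])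
  then have "(\<lambda>N. Re (\<Sum>n=1..N. of_real (chebyshev_psi n / n - 1) / of_nat n)) \<longlonglongrightarrow> Re (F 1)"
    by (rule tendsto_Re)
  moreover have "Re (\<Sum>n=1..N. of_real (chebyshev_psi n / n - 1) / of_nat n) = (\<Sum>n=1..N. (chebyshev_psi n / n - 1) / n)" for N
    unfolding Re_sum by (intro sum.cong) (auto simp: Re_divide_of_nat)
  ultimately show ?thesis unfolding convergent_def by auto
qed

corollary prime_in_short_interval:
  fixes \<delta> :: real
  assumes "0 < \<delta>" "\<delta> < 1"
  shows "\<forall>\<^sub>F k in sequentially. \<exists>p. prime p \<and> (1 - \<delta>) * real k \<le> real p \<and> p \<le> k"
  by (rule prime_in_interval_of_psi_convergent[OF psi_error_sum_convergent assms])


section \<open>Off-diagonal Hales-Jewett numbers\<close>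

lemma sum_list_subst_var:
  "sum_list (subst_var w a) = sum_list (subst_var w 0) + count_list w None * a"
  by (induction w) (auto simp: subst_var_def split: option.splits)

lemma count_list_None_pos: "None \<in> set w \<Longrightarrow> count_list w None > 0"
  by (metis count_list_0_iff gr0I)

text \<open>
  Colour 2 is given to coordinate sums divisible by \<open>q\<close>. The number \<open>s\<close> of variable positions
  satisfies \<open>0 < s < q\<close>, so it is invertible modulo \<open>q\<close>: every full line has a point of colour 2,
  and no two consecutive points of a line both have it.
\<close>

lemma not_HJ_property_below_prime:
  assumes q: "prime q" "q \<le> k" and n: "n < q"
  shows "\<not> HJ_property k 2 n"
proof
  assume HJ: "HJ_property k 2 n"
  have k2: "max k 2 = k" using q prime_ge_2_nat[of q] by simp
  define c :: "nat list \<Rightarrow> nat" where "c p = (if q dvd sum_list p then 2 else 1)" for p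
  have "c \<in> words (max k 2) n \<rightarrow> {1, 2}" by (auto simp: c_def)
  then consider L where "is_line k n k L" "monochromatic c 1 L"
    | L where "is_line k n 2 L" "monochromatic c 2 L"
    using HJ unfolding HJ_property_def k2 by blast
  then show False
  proof cases
    case 1
    then obtain w where w: "w \<in> variable_words k n" and L: "L = subst_var w ` {1..k}"
      by (auto simp: is_line_def)
    define s where "s = count_list w None"
    have s: "0 < s" "s < q"
      using w n count_list_None_pos[of w] count_le_length[of w None]
      by (auto simp: s_def variable_words_def)
    have cop: "coprime s q"
      using s q(1) by (metis coprime_commute nat_dvd_not_less prime_imp_coprime)
    obtain x where x: "[s * x = 1] (mod q)"
      using cong_solve_coprime_nat[OF cop] by auto
    define b where "b = sum_list (subst_var w 0)"
    define y where "y = x * (q - b mod q)"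
    have "[s * y = 1 * (q - b mod q)] (mod q)"
      unfolding y_def mult.assoc[symmetric] using x by (rule cong_scalar_right)
    then have "[b + s * y = b + (q - b mod q)] (mod q)"
      by (simp add: cong_add_lcancel_nat)
    moreover have "[b + (q - b mod q) = b mod q + (q - b mod q)] (mod q)"
      by (intro cong_add) auto
    moreover have "b mod q + (q - b mod q) = q" using q(1) prime_gt_0_nat by simp
    ultimately have "[b + s * y = q] (mod q)" by (metis cong_trans)
    then have dy: "q dvd b + s * y" by (simp add: cong_dvd_iff)
    \<comment> \<open>The letters start at 1, so the residue 0 is represented by \<open>q\<close>.\<close>
    define a where "a = (if y mod q = 0 then q else y mod q)"
    have "y mod q < q" using q(1) prime_gt_0_nat by simp
    then have "1 \<le> a" "a \<le> q" by (simp_all add: a_def)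
    then have a: "a \<in> {1..k}" using q(2) by simp
    have "[a = y] (mod q)" unfolding Cong.cong_def a_def by simp
    have "[b + s * a = b + s * y] (mod q)"
      using \<open>[a = y] (mod q)\<close> by (intro cong_add cong_mult) auto
    with dy have "q dvd b + s * a" using cong_dvd_iff by blast
    then have "c (subst_var w a) = 2"
      using sum_list_subst_var[of w a] by (simp add: c_def b_def s_def)
    then show False using 1(2) a by (auto simp: L monochromatic_def)
  next
    case 2
    then obtain w i where w: "w \<in> variable_words k n" and L: "L = subst_var w ` {i + 1..i + 2}"
      by (auto simp: is_line_def)
    define s where "s = count_list w None"
    have s: "0 < s" "s < q"
      using w n count_list_None_pos[of w] count_le_length[of w None]
      by (auto simp: s_def variable_words_def)
    have "c (subst_var w (i + 1)) = 2" "c (subst_var w (i + 2)) = 2"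
      using 2(2) by (auto simp: L monochromatic_def)
    then have "q dvd sum_list (subst_var w (i + 1))" "q dvd sum_list (subst_var w (i + 2))"
      by (auto simp: c_def split: if_splits)
    moreover have "sum_list (subst_var w (i + 2)) = sum_list (subst_var w (i + 1)) + s"
      using sum_list_subst_var[of w "i + 1"] sum_list_subst_var[of w "i + 2"] by (simp add: s_def)
    ultimately have "q dvd s" by (simp add: dvd_add_right_iff)
    then show False using s by (auto dest: dvd_imp_le)
  qed
qed

definition step_word :: "nat \<Rightarrow> nat \<Rightarrow> nat option list" where
  "step_word k i = None # replicate i (Some 1) @ replicate (k - i) (Some 2)"

text \<open>
  Making the positions where the two words differ into the variable, and fixing the letter \<open>a\<close>
  in front, gives a variable word whose values at 1 and 2 are the two points.
\<close>

lemma step_words_adjacent: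
  assumes "a \<in> {1..k}" "k \<ge> 2" "i < j" "j \<le> k"
  shows "is_line k (Suc k) 2 {subst_var (step_word k i) a, subst_var (step_word k j) a}"
proof -
  define v where "v = Some a # replicate i (Some 1) @ replicate (j - i) None @ replicate (k - j) (Some 2)"
  have v: "v \<in> variable_words k (Suc k)"
    using assms by (auto simp: v_def variable_words_def)
  have "replicate (k - i) (2::nat) = replicate (j - i) 2 @ replicate (k - j) 2"
    using assms by (simp flip: replicate_add)
  then have 2: "subst_var v 2 = subst_var (step_word k i) a"
    by (simp add: v_def step_word_def subst_var_def)
  have "replicate j (1::nat) = replicate i 1 @ replicate (j - i) 1"
    using assms by (simp flip: replicate_add)
  then have 1: "subst_var v 1 = subst_var (step_word k j) a"
    by (simp add: v_def step_word_def subst_var_def)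
  have "{0 + 1..0 + 2::nat} = {1, 2}" by auto
  then have "{subst_var (step_word k i) a, subst_var (step_word k j) a} = subst_var v ` {0 + 1..0 + 2}"
    using 1 2 by auto
  then show ?thesis
    unfolding is_line_def using v assms(2) by (intro bexI[of _ v] exI[of _ 0]) auto
qed

text \<open>
  Each of the \<open>k\<close> letters excludes at most one of the \<open>k + 1\<close> step words.
\<close>

lemma HJ_property_Suc:
  assumes k: "k \<ge> 2"
  shows "HJ_property k 2 (Suc k)"
proof -
  have k2: "max k 2 = k" using k by simp
  show ?thesis
    unfolding HJ_property_def k2
  proof (intro ballI disjCI)
    fix c :: "nat list \<Rightarrow> nat"
    assume c: "c \<in> words k (Suc k) \<rightarrow> {1, 2}"
      and no2: "\<not> (\<exists>L. is_line k (Suc k) 2 L \<and> monochromatic c 2 L)"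
    define B where "B a = {i \<in> {..k}. c (subst_var (step_word k i) a) = 2}" for a
    have "card (B a) \<le> 1" if "a \<in> {1..k}" for a
    proof -
      have "i = j" if "i \<in> B a" "j \<in> B a" for i j
        using that no2 step_words_adjacent[OF \<open>a \<in> {1..k}\<close> k, of i j]
          step_words_adjacent[OF \<open>a \<in> {1..k}\<close> k, of j i]
        by (cases i j rule: linorder_cases) (auto simp: B_def monochromatic_def)
      then show ?thesis
        using card_le_Suc0_iff_eq[of "B a"] by (auto simp: B_def)
    qed
    then have "card (\<Union>a\<in>{1..k}. B a) \<le> (\<Sum>a\<in>{1..k}. 1)"
      by (intro card_UN_le[THEN order.trans] sum_mono) auto
    then have "card (\<Union>a\<in>{1..k}. B a) < card {..k}" by simp
    moreover have "finite (\<Union>a\<in>{1..k}. B a)" by (auto simp: B_def)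
    ultimately have "\<not> {..k} \<subseteq> (\<Union>a\<in>{1..k}. B a)"
      using card_mono leD by blast
    then obtain i where i: "i \<le> k" "\<And>a. a \<in> {1..k} \<Longrightarrow> i \<notin> B a"
      by blast
    have w: "step_word k i \<in> variable_words k (Suc k)"
      using i k by (auto simp: step_word_def variable_words_def)
    have "c (subst_var (step_word k i) a) = 1" if a: "a \<in> {1..k}" for a
    proof -
      have "subst_var (step_word k i) a \<in> words k (Suc k)"
        using a i k by (auto simp: words_def step_word_def subst_var_def)
      then show ?thesis using c i a by (auto simp: B_def)
    qed
    then show "\<exists>L. is_line k (Suc k) k L \<and> monochromatic c 1 L"
      using w by (intro exI[of _ "subst_var (step_word k i) ` {0 + 1..0 + k}"])
        (auto simp: is_line_def monochromatic_def)
  qed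
qed

text \<open>
  The upper bound also shows that a dimension with the required property exists, which makes the
  least one meaningful.
\<close>

lemma HJ_bounds:
  assumes "prime q" "q \<le> k"
  shows "q \<le> HJ k 2" "HJ k 2 \<le> Suc k"
proof -
  have k: "k \<ge> 2" using assms prime_ge_2_nat le_trans by blast
  have ex: "0 < Suc k \<and> HJ_property k 2 (Suc k)" using HJ_property_Suc[OF k] by simp
  show "HJ k 2 \<le> Suc k" unfolding HJ_def using ex by (rule Least_le)
  have "HJ_property k 2 (HJ k 2)"
    unfolding HJ_def using LeastI[of "\<lambda>n. 0 < n \<and> HJ_property k 2 n", OF ex] by simp
  then show "q \<le> HJ k 2" using not_HJ_property_below_prime[OF assms] 
    by (meson not_less)
qed


theorem theorem18:
  "\<exists>\<epsilon> :: nat \<Rightarrow> real. \<epsilon> \<longlonglongrightarrow> 0 \<and>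
     (\<forall>k \<ge> 1. real (HJ k 2) = real k * (1 - \<epsilon> k))"
proof (intro exI conjI allI impI)
  define \<epsilon> where "\<epsilon> k = 1 - real (HJ k 2) / real k" for k
  show "real (HJ k 2) = real k * (1 - \<epsilon> k)" if "k \<ge> 1" for k
    using that by (simp add: \<epsilon>_def)
  show "\<epsilon> \<longlonglongrightarrow> 0"
  proof (rule tendstoI)
    fix e :: real assume e: "e > 0"
    define \<delta> where "\<delta> = min (e / 2) (1 / 2)"
    have \<delta>: "0 < \<delta>" "\<delta> < 1" "\<delta> < e" using e by (auto simp: \<delta>_def)
    have "\<forall>\<^sub>F k::nat in sequentially. 1 / real k < e" using e by real_asymp
    then show "\<forall>\<^sub>F k in sequentially. dist (\<epsilon> k) 0 < e"
      using prime_in_short_interval[OF \<delta>(1,2)] eventually_gt_at_top[of 0]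
    proof eventually_elim
      case (elim k)
      then obtain p where p: "prime p" "(1 - \<delta>) * real k \<le> real p" "p \<le> k" by blast
      have "(1 - \<delta>) * real k \<le> real (HJ k 2)" "real (HJ k 2) \<le> real k + 1"
        using HJ_bounds[OF p(1,3)] p(2) by linarith+
      then have "1 - \<delta> \<le> real (HJ k 2) / real k" "real (HJ k 2) / real k \<le> 1 + 1 / real k"
        using elim by (simp_all add: field_simps)
      then show ?case using \<delta> elim by (simp add: \<epsilon>_def dist_real_def)
    qed
  qed
qed

end
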